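(* Let $1\le d<n$ be integers, let $x_1,\dots,x_N\in\mathbb{R}^n$ be such that $n+1$ of these points are affinely independent, and let $\beta_1,\dots,\beta_N\in\mathbb{R}_{\ge 0}$. Let $f$ be the Gaussian density function. For $\sigma>0$, $U\in\mathrm{St}(d,n)$, $b\in\mathbb{R}^n$, $\mu\in\mathbb{R}^d$, $\Sigma\in\mathrm{SPD}(d)$ put $$ \tilde\Sigma=\Big(\tfrac1{\sigma^2}(I_n-UU^{\mathrm T})+U\Sigma^{-1}U^{\mathrm T}\Big)^{-1},\qquad \tilde\mu=\tilde\Sigma U\Sigma^{-1}\mu+b, $$ and $$ J(U,b,\mu,\Sigma,\sigma)=\sum_{i=1}^N\beta_i\log f(x_i\,|\,\tilde\mu,\tilde\Sigma). $$ Define $$ m=\sum_{i=1}^N\beta_ix_i,\quad C=\sum_{i=1}^N\beta_ix_ix_i^{\mathrm T},\quad \alpha=\sum_{i=1}^N\beta_i,\quad S=C-\tfrac1\alpha mm^{\mathrm T}. $$ (i) For fixed $\sigma^2$ (with $\sigma>0$), a solution of the problem of maximizing $(U,b,\mu,\Sigma)\mapsto J(U,b,\mu,\Sigma,\sigma)$ over $\mathrm{St}(d,n)\times\mathbb{R}^n\times\mathbb{R}^d\times\mathrm{SPD}(d)$ is given by $(\hat U,\hat b,\hat\mu,\hat\Sigma)$ with $$ \hat\mu=0,\qquad \hat\Sigma=\tfrac1\alpha\hat U^{\mathrm T}S\hat U,\qquad \hat b=\tfrac1\alpha m, $$ where $$ \hat U\in\operatorname*{argmin}_{U\in\mathrm{St}(d,n)}G(U),\qquad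 G(U)=-\tfrac{1}{\sigma^2}\operatorname{tr}(U^{\mathrm T}SU)+\alpha\log\big(|U^{\mathrm T}SU|\big). $$ (ii) If $\sigma$ is learned, i.e. $J$ is maximized over $(U,b,\mu,\Sigma,\sigma)\in\mathrm{St}(d,n)\times\mathbb{R}^n\times\mathbb{R}^d\times\mathrm{SPD}(d)\times(0,\infty)$, then a solution is given by $(\hat U,\hat b,\hat\mu,\hat\Sigma,\hat\sigma)$ with $$ \hat\mu=0,\quad \hat\Sigma=\tfrac1\alpha\hat U^{\mathrm T}S\hat U,\quad \hat b=\tfrac1\alpha m,\quad \hat\sigma^2=\tfrac{1}{\alpha(n-d)}\big(\operatorname{tr}(S)-\operatorname{tr}(\hat U^{\mathrm T}S\hat U)\big), $$ where now the function $G$ is replaced by $$ G(U)=(n-d)\log\big(\operatorname{tr}(S)-\operatorname{tr}(U^{\mathrm T}SU)\big)+\log\big(|U^{\mathrm T}SU|\big), $$ that is, $\hat U\in\operatorname*{argmin}_{U\in\mathrm{St}(d,n)}G(U)$ for this $G$.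
   Context: $\mathrm{SPD}(m)$ is the set of real symmetric positive definite $m\times m$ matrices. $\mathrm{St}(d,n)=\{U\in\mathbb{R}^{n\times d}: U^{\mathrm T}U=I_d\}$ is the Stiefel manifold. $\mathbb{R}_{\ge 0}$ is the set of nonnegative reals. $|A|$ denotes the determinant of a square matrix $A$ and $\operatorname{tr}$ the trace. The Gaussian density on $\mathbb{R}^n$ with mean $\nu\in\mathbb{R}^n$ and covariance $\Lambda\in\mathrm{SPD}(n)$ is $f(x|\nu,\Lambda)=(2\pi)^{-n/2}|\Lambda|^{-1/2}\exp\big(-\tfrac12(x-\nu)^{\mathrm T}\Lambda^{-1}(x-\nu)\big)$.
   Formalization: The argmin of G is taken where its logarithms are defined, and existence of Û is claimed only if n+1 affinely independent points have positive weight β_i; otherwise S is singular (e.g. one positive β_i gives S=0), and no solution of this form exists or 1/α is undefined. *)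

theory Defs
  imports "HOL-Analysis.Analysis"
begin

text \<open>A matrix with \<open>n\<close> rows and \<open>d\<close> columns has type \<^typ>\<open>real^'d^'n\<close>.\<close>

definition Stiefel :: "(real^'d^'n) set" where
  "Stiefel = {U. transpose U ** U = mat 1}"

definition SPD :: "(real^'m^'m) set" where
  "SPD = {A. transpose A = A \<and> (\<forall>v. v \<noteq> 0 \<longrightarrow> 0 < v \<bullet> (A *v v))}"

definition outer :: "real^'n \<Rightarrow> real^'n \<Rightarrow> real^'n^'n" where
  "outer v w = (\<chi> i j. v $ i * w $ j)"

definition gaussian_density :: "real^'n \<Rightarrow> real^'n \<Rightarrow> real^'n^'n \<Rightarrow> real" where
  "gaussian_density x \<nu> \<Lambda> =
     (2 * pi) powr (- real CARD('n) / 2) * det \<Lambda> powr (- 1 / 2)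
       * exp (- (1 / 2) * ((x - \<nu>) \<bullet> (matrix_inv \<Lambda> *v (x - \<nu>))))"

definition Sigma_tilde :: "real^'d^'n \<Rightarrow> real^'d^'d \<Rightarrow> real \<Rightarrow> real^'n^'n" where
  "Sigma_tilde U \<Sigma> \<sigma> =
     matrix_inv ((1 / \<sigma>\<^sup>2) *\<^sub>R (mat 1 - U ** transpose U) + U ** matrix_inv \<Sigma> ** transpose U)"

definition mu_tilde ::
  "real^'d^'n \<Rightarrow> real^'n \<Rightarrow> real^'d \<Rightarrow> real^'d^'d \<Rightarrow> real \<Rightarrow> real^'n" where
  "mu_tilde U b \<mu> \<Sigma> \<sigma> = (Sigma_tilde U \<Sigma> \<sigma> ** U ** matrix_inv \<Sigma>) *v \<mu> + b"

definition J ::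
  "(nat \<Rightarrow> real^'n) \<Rightarrow> (nat \<Rightarrow> real) \<Rightarrow> nat \<Rightarrow>
   real^'d^'n \<Rightarrow> real^'n \<Rightarrow> real^'d \<Rightarrow> real^'d^'d \<Rightarrow> real \<Rightarrow> real" where
  "J x \<beta> N U b \<mu> \<Sigma> \<sigma> =
     (\<Sum>i=1..N. \<beta> i * ln (gaussian_density (x i) (mu_tilde U b \<mu> \<Sigma> \<sigma>) (Sigma_tilde U \<Sigma> \<sigma>)))"

definition weight_total :: "(nat \<Rightarrow> real) \<Rightarrow> nat \<Rightarrow> real" where
  "weight_total \<beta> N = (\<Sum>i=1..N. \<beta> i)"

definition first_moment :: "(nat \<Rightarrow> real^'n) \<Rightarrow> (nat \<Rightarrow> real) \<Rightarrow> nat \<Rightarrow> real^'n" where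
  "first_moment x \<beta> N = (\<Sum>i=1..N. \<beta> i *\<^sub>R x i)"

definition second_moment :: "(nat \<Rightarrow> real^'n) \<Rightarrow> (nat \<Rightarrow> real) \<Rightarrow> nat \<Rightarrow> real^'n^'n" where
  "second_moment x \<beta> N = (\<Sum>i=1..N. \<beta> i *\<^sub>R outer (x i) (x i))"

definition scatter :: "(nat \<Rightarrow> real^'n) \<Rightarrow> (nat \<Rightarrow> real) \<Rightarrow> nat \<Rightarrow> real^'n^'n" where
  "scatter x \<beta> N = second_moment x \<beta> N
     - (1 / weight_total \<beta> N) *\<^sub>R outer (first_moment x \<beta> N) (first_moment x \<beta> N)"

text \<open>Among the points indexed by \<open>I\<close> there are \<open>n + 1\<close> affinely independent ones; since
  \<^const>\<open>affine_dependent\<close> speaks about sets, injectivity excludes repeated points.\<close>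

definition affinely_independent_points :: "(nat \<Rightarrow> real^'n) \<Rightarrow> nat set \<Rightarrow> bool" where
  "affinely_independent_points x I \<longleftrightarrow>
     (\<exists>K\<subseteq>I. card K = CARD('n) + 1 \<and> inj_on x K \<and> \<not> affine_dependent (x ` K))"

text \<open>The two functions to be minimized, for fixed and for learned \<open>\<sigma>\<close>. Each comes with the set of
  points of the Stiefel manifold at which the logarithms in it are defined (\<^term>\<open>ln (0::real)\<close> is
  a junk value in HOL). If \<open>S\<close> is positive definite and \<open>d < n\<close>, this is the whole Stiefel manifold;
  it is smaller only if the points of positive weight lie on a common hyperplane.\<close>

definition G_fixed :: "real^'n^'n \<Rightarrow> real \<Rightarrow> real \<Rightarrow> real^'d^'n \<Rightarrow> real" where
  "G_fixed S \<alpha> \<sigma> U =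
     - (1 / \<sigma>\<^sup>2) * trace (transpose U ** S ** U) + \<alpha> * ln (det (transpose U ** S ** U))"

definition G_fixed_dom :: "real^'n^'n \<Rightarrow> (real^'d^'n) set" where
  "G_fixed_dom S = {U \<in> Stiefel. 0 < det (transpose U ** S ** U)}"

definition G_learned :: "real^'n^'n \<Rightarrow> real^'d^'n \<Rightarrow> real" where
  "G_learned S (U :: real^'d^'n) =
     (real CARD('n) - real CARD('d)) * ln (trace S - trace (transpose U ** S ** U))
       + ln (det (transpose U ** S ** U))"

definition G_learned_dom :: "real^'n^'n \<Rightarrow> (real^'d^'n) set" where
  "G_learned_dom S = {U \<in> Stiefel. 0 < trace S - trace (transpose U ** S ** U)
                                  \<and> 0 < det (transpose U ** S ** U)}"

end

(* With c = m / alpha and the precision matrix P = (I - V V^T) / sigma^2 + V Sigma^-1 V^T, expanding the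
   weighted quadratic forms around c turns J into a constant plus (alpha ln det P - tr (P S)) / 2 minus
   a nonnegative quadratic form in c - mu_tilde. An orthonormal eigenbasis of P adapted to V gives
   det P = sigma^(-2 (n - d)) / det Sigma, and ln det (Sigma^-1 W) <= tr (Sigma^-1 W) - d with
   W = V^T S V / alpha optimizes Sigma; what is left is -G (V) / 2 up to constants. For learned sigma the
   one-variable minimization in sigma^2 is carried out last.

   This needs S to be positive definite. If S is singular, rotating a unit vector of the column space of U
   towards a kernel vector of S drives det (V^T S V) to 0, so G is unbounded below and has no minimizer. *)
theory Submission
  imports Defs
begin

text \<open>Points of weight zero do not enter S, so the points that count may lie on a common
  hyperplane and S may be singular. In the implications about minimizers, positive definiteness is
  therefore not read off the data but extracted from the minimizer U itself. Membership of U in the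
  domain of the logarithms gives det (U^T S U) > 0. This forces alpha > 0, since otherwise all
  weights and S vanish, and it keeps the kernel of S disjoint from the column space of U apart from
  0, so that there is a direction to rotate into. The rotation has to be quantitative: the
  determinant is multiplied by a prescribed delta^2 while the trace does not grow, and delta is
  taken so small that the drop of the logarithm exceeds anything the trace term can give back.
  Conversely, for positive definite S both functions G are continuous on the compact Stiefel
  manifold, which supplies the minimizers.\<close>

declare transpose_matrix_vector [simp del] vector_transpose_matrix [simp del]

subsection \<open>Matrix algebra\<close>

lemma inner_matrix_vector_right:
  fixes A :: "real^'n^'m"
  shows "x \<bullet> (A *v y) = (transpose A *v x) \<bullet> y"
  by (simp add: transpose_matrix_vector dot_lmul_matrix)

lemma inner_matrix_vector_left:
  fixes A :: "real^'n^'m"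
  shows "(A *v x) \<bullet> y = x \<bullet> (transpose A *v y)"
  by (metis inner_matrix_vector_right transpose_transpose)

lemma matrix_add_rdistrib: "(B + C) ** (A :: real^'n^'m) = B ** A + C ** A"
  by (simp add: matrix_matrix_mult_def vec_eq_iff sum.distrib distrib_right)

lemma matrix_diff_ldistrib: "(A :: real^'n^'m) ** (B - C) = A ** B - A ** C"
  by (simp add: matrix_matrix_mult_def vec_eq_iff sum_subtractf right_diff_distrib)

lemma matrix_diff_rdistrib: "(B - C) ** (A :: real^'n^'m) = B ** A - C ** A"
  by (simp add: matrix_matrix_mult_def vec_eq_iff sum_subtractf left_diff_distrib)

lemma scaleR_matrix_mult_left: "(k *\<^sub>R (A :: real^'n^'m)) ** B = k *\<^sub>R (A ** B)"
  by (simp add: scalar_matrix_assoc)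

lemma scaleR_matrix_mult_right: "(A :: real^'n^'m) ** (k *\<^sub>R B) = k *\<^sub>R (A ** B)"
  by (simp add: matrix_scalar_ac scalar_matrix_assoc)

lemma scaleR_matrix_vector_mult: "(k *\<^sub>R (A :: real^'n^'m)) *v x = k *\<^sub>R (A *v x)"
  by (simp add: matrix_vector_mult_def vec_eq_iff sum_distrib_left mult.assoc)

lemma transpose_add: "transpose (A + B) = transpose A + transpose (B :: real^'n^'m)"
  by (simp add: transpose_def vec_eq_iff)

lemma transpose_diff: "transpose (A - B) = transpose A - transpose (B :: real^'n^'m)"
  by (simp add: transpose_def vec_eq_iff)

lemma trace_scaleR: "trace (k *\<^sub>R A) = k * trace (A :: real^'n^'n)"
  by (simp add: trace_def sum_distrib_left)

lemma trace_sum: "trace (\<Sum>i\<in>I. f i) = (\<Sum>i\<in>I. trace (f i :: real^'n^'n))"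
  by (induction I rule: infinite_finite_induct) (auto simp: trace_add trace_def[of 0])

lemma matrix_mult_sum_right: "(A :: real^'n^'m) ** (\<Sum>i\<in>I. f i) = (\<Sum>i\<in>I. A ** f i)"
  by (induction I rule: infinite_finite_induct) (auto simp: matrix_add_ldistrib)

lemmas matrix_algebra = matrix_add_ldistrib matrix_add_rdistrib matrix_diff_ldistrib
  matrix_diff_rdistrib scaleR_matrix_mult_left scaleR_matrix_mult_right

text \<open>\<open>matrix_inv\<close> is a Hilbert choice among two-sided inverses. For square
  matrices a one-sided inverse is already two-sided, so the choice is forced.\<close>

lemma matrix_inv_unique:
  fixes A B :: "real^'n^'n"
  assumes "A ** B = mat 1"
  shows "matrix_inv A = B"
proof -
  have BA: "B ** A = mat 1" using assms matrix_left_right_inverse by blast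
  have "A ** matrix_inv A = mat 1 \<and> matrix_inv A ** A = mat 1"
    unfolding matrix_inv_def by (rule someI[of _ B]) (use assms BA in auto)
  then have "B ** (A ** matrix_inv A) = B" by simp
  then show ?thesis using BA by (simp add: matrix_mul_assoc)
qed

lemma matrix_inv_right:
  fixes A :: "real^'n^'n"
  assumes "det A \<noteq> 0"
  shows "A ** matrix_inv A = mat 1"
proof -
  obtain B where "A ** B = mat 1" using assms by (auto simp: invertible_det_nz[symmetric] invertible_def)
  then show ?thesis using matrix_inv_unique by metis
qed

lemma matrix_inv_left:
  fixes A :: "real^'n^'n"
  assumes "det A \<noteq> 0"
  shows "matrix_inv A ** A = mat 1"
  using matrix_inv_right[OF assms] matrix_left_right_inverse by blast

lemma matrix_inv_involution:
  fixes A :: "real^'n^'n"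
  assumes "det A \<noteq> 0"
  shows "matrix_inv (matrix_inv A) = A"
  by (rule matrix_inv_unique) (rule matrix_inv_left[OF assms])

lemma det_matrix_inv:
  fixes A :: "real^'n^'n"
  assumes "det A \<noteq> 0"
  shows "det (matrix_inv A) = 1 / det A"
proof -
  have "det A * det (matrix_inv A) = 1"
    using matrix_inv_right[OF assms] by (metis det_I det_mul)
  then show ?thesis using assms by (simp add: field_simps)
qed

text \<open>Rectangular counterpart of \<open>outer\<close>: the rotation of a Stiefel matrix adds a
  multiple of \<open>outer_product z h\<close> with \<open>z\<close> in the n-dimensional and
  \<open>h\<close> in the d-dimensional space.\<close>

definition outer_product :: "real^'n \<Rightarrow> real^'m \<Rightarrow> real^'m^'n" where
  "outer_product v w = (\<chi> i j. v $ i * w $ j)"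

lemma outer_eq_outer_product: "outer v w = outer_product v w"
  by (simp add: outer_def outer_product_def)

lemma transpose_outer_product: "transpose (outer_product v w) = outer_product w v"
  by (simp add: outer_product_def transpose_def vec_eq_iff)

lemma matrix_mult_outer_product: "A ** outer_product v w = outer_product (A *v v) w"
  by (simp add: outer_product_def matrix_matrix_mult_def matrix_vector_mult_def vec_eq_iff
      sum_distrib_right mult.assoc)

lemma outer_product_matrix_mult: "outer_product v w ** A = outer_product v (transpose A *v w)"
  by (simp add: outer_product_def matrix_matrix_mult_def matrix_vector_mult_def transpose_def vec_eq_iff
      sum_distrib_left algebra_simps)

lemma outer_product_vector_mult: "outer_product v w *v y = (w \<bullet> y) *\<^sub>R v"
  by (simp add: outer_product_def matrix_vector_mult_def vec_eq_iff inner_vec_def sum_distrib_left algebra_simps)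

lemma outer_product_scaleR_left: "outer_product (k *\<^sub>R v) w = k *\<^sub>R outer_product v w"
  by (simp add: outer_product_def vec_eq_iff)

lemma outer_product_minus_left: "outer_product (- v) w = - outer_product v w"
  by (simp add: outer_product_def vec_eq_iff)

lemma outer_product_zero: "outer_product 0 w = 0" "outer_product v 0 = 0"
  by (simp_all add: outer_product_def vec_eq_iff)

lemma trace_outer_product: "trace (outer_product v w) = v \<bullet> w"
  by (simp add: trace_def outer_product_def inner_vec_def)

lemma matrix_mult_column: "A *v column j (B :: real^'n^'m) = column j (A ** B)"
  by (simp add: matrix_vector_mult_def column_def matrix_matrix_mult_def vec_eq_iff)

section \<open>Compressions V^T A V and orthogonal conjugation\<close>

lemma sandwich_component:
  fixes A :: "real^'n^'n" and V :: "real^'d^'n"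
  shows "(transpose V ** A ** V) $ i $ j = column i V \<bullet> (A *v column j V)"
proof -
  have "(transpose V ** (A ** V)) $ i $ j = column i V \<bullet> column j (A ** V)"
    unfolding matrix_matrix_mult_def[of "transpose V"]
    by (simp add: transpose_def column_def inner_vec_def)
  then show ?thesis by (simp add: matrix_mult_column matrix_mul_assoc)
qed

lemma sandwich_inner:
  fixes A :: "real^'n^'n" and V :: "real^'d^'n"
  shows "x \<bullet> ((transpose V ** A ** V) *v y) = (V *v x) \<bullet> (A *v (V *v y))"
  by (simp add: matrix_vector_mul_assoc[symmetric] inner_matrix_vector_left)

lemma column_inner_orthogonal_matrix:
  fixes Q :: "real^'n^'n"
  assumes "orthogonal_matrix Q"
  shows "column i Q \<bullet> column j Q = (if i = j then 1 else 0)"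
  using assms by (simp add: orthogonal_matrix matrix_mult_transpose_dot_column vec_eq_iff mat_def)

lemma diagonalized:
  fixes A Q :: "real^'n^'n"
  assumes "orthogonal_matrix Q" "\<And>j. A *v column j Q = l j *\<^sub>R column j Q"
  shows "transpose Q ** A ** Q = (\<chi> i j. if i = j then l i else 0)"
  by (simp add: vec_eq_iff sandwich_component assms(2) column_inner_orthogonal_matrix[OF assms(1)])

lemma trace_orthogonal_conj:
  fixes A Q :: "real^'n^'n"
  assumes "orthogonal_matrix Q"
  shows "trace (transpose Q ** A ** Q) = trace A"
proof -
  have "trace (transpose Q ** (A ** Q)) = trace (A ** (Q ** transpose Q))"
    by (subst trace_mul_sym) (simp add: matrix_mul_assoc)
  moreover have "Q ** transpose Q = mat 1" using assms by (simp add: orthogonal_matrix_def)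
  ultimately show ?thesis by (simp only: matrix_mul_assoc[symmetric] matrix_mul_rid)
qed

lemma det_orthogonal_conj:
  fixes A Q :: "real^'n^'n"
  assumes "orthogonal_matrix Q"
  shows "det (transpose Q ** A ** Q) = det A"
proof -
  have "det Q * det Q = 1"
    using assms by (metis det_I det_mul det_transpose orthogonal_matrix_def)
  then show ?thesis by (simp add: det_mul algebra_simps)
qed

lemma det_eq_prod_eigenvalues:
  fixes A Q :: "real^'n^'n"
  assumes "orthogonal_matrix Q" "\<And>j. A *v column j Q = l j *\<^sub>R column j Q"
  shows "det A = (\<Prod>j\<in>UNIV. l j)"
proof -
  have "det A = det ((\<chi> i j. if i = j then l i else 0) :: real^'n^'n)"
    using det_orthogonal_conj[OF assms(1), of A] diagonalized[OF assms] by simp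
  also have "\<dots> = (\<Prod>j\<in>UNIV. l j)" by (subst det_diagonal) auto
  finally show ?thesis .
qed

lemma trace_eq_sum_eigenvalues:
  fixes A Q :: "real^'n^'n"
  assumes "orthogonal_matrix Q" "\<And>j. A *v column j Q = l j *\<^sub>R column j Q"
  shows "trace A = (\<Sum>j\<in>UNIV. l j)"
  using trace_orthogonal_conj[OF assms(1), of A] diagonalized[OF assms] by (simp add: trace_def)

subsection \<open>Orthonormal completion and the spectral theorem\<close>

lemma card_basis:
  fixes B :: "(real^'n) set"
  assumes "independent B" "span B = UNIV"
  shows "card B = CARD('n)"
  using dim_span[of B] dim_eq_card_independent[OF assms(1)] assms(2) by simp

text \<open>An orthonormal basis \<open>C\<close> of the orthogonal complement of the prescribed
  columns has exactly as many elements as there are free column positions, so a bijection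
  \<open>g\<close> from \<open>- I\<close> to \<open>C\<close> fills the gaps. With
  \<open>I = UNIV\<close> this merely packs an orthonormal family into an orthogonal matrix.\<close>

lemma orthogonal_matrix_extend:
  fixes f :: "'n::finite \<Rightarrow> real^'n"
  assumes "\<And>i j. i \<in> I \<Longrightarrow> j \<in> I \<Longrightarrow> f i \<bullet> f j = (if i = j then 1 else 0)"
  obtains Q :: "real^'n^'n" where "orthogonal_matrix Q" "\<And>i. i \<in> I \<Longrightarrow> column i Q = f i"
proof -
  let ?B = "f ` I"
  have inj: "inj_on f I" using assms by (metis inj_onI zero_neq_one)
  have fin: "finite ?B" by simp
  have po: "pairwise orthogonal ?B" using assms by (auto simp: pairwise_def orthogonal_def)
  define T where "T = {x. \<forall>b\<in>?B. orthogonal x b}"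
  have sT: "subspace T" unfolding T_def by (auto simp: subspace_def orthogonal_clauses)
  obtain C where C: "C \<subseteq> T" "pairwise orthogonal C" "\<And>x. x \<in> C \<Longrightarrow> norm x = 1"
    "independent C" "span C = T" using orthonormal_basis_subspace[OF sT] by metis
  have disj: "?B \<inter> C = {}"
    using C(1,3) by (force simp: T_def orthogonal_self)
  have pBC: "pairwise orthogonal (?B \<union> C)"
    using po C(1,2) by (auto simp: pairwise_def T_def orthogonal_commute)
  have n1: "norm x = 1" if "x \<in> ?B \<union> C" for x
    using that C(3) assms by (auto simp: norm_eq_sqrt_inner)
  have ind: "independent (?B \<union> C)"
    by (rule pairwise_orthogonal_independent[OF pBC]) (use n1 in force)
  have "span (?B \<union> C) = UNIV"
  proof -
    have "x \<in> span (?B \<union> C)" for x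
    proof -
      obtain y z where yz: "y \<in> span ?B" "\<And>w. w \<in> span ?B \<Longrightarrow> orthogonal z w" "x = y + z"
        using orthogonal_subspace_decomp_exists by blast
      have "z \<in> T" using yz(2) by (auto simp: T_def span_base)
      then have "z \<in> span C" using C by simp
      then show ?thesis using yz by (meson span_add span_mono subsetD sup_ge1 sup_ge2)
    qed
    then show ?thesis by auto
  qed
  then have "card (?B \<union> C) = CARD('n)"
    by (rule card_basis[OF ind])
  moreover have finC: "finite C" using C(4) by (rule finiteI_independent)
  ultimately have "card I + card C = CARD('n)"
    using disj inj by (simp add: card_Un_disjoint card_image)
  then have "card (- I) = card C" by (simp add: Compl_eq_Diff_UNIV card_Diff_subset)
  then obtain g where g: "bij_betw g (- I) C"
    using finite_same_card_bij[of "- I" C] finC by auto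
  define h where "h i = (if i \<in> I then f i else g i)" for i
  have hB: "h i \<in> ?B \<union> C" for i using g by (auto simp: h_def bij_betw_def)
  have hinj: "h i \<noteq> h j" if "i \<noteq> j" for i j
    using that inj g disj by (auto simp: h_def bij_betw_def inj_on_def)
  have "orthogonal (h i) (h j)" if "i \<noteq> j" for i j
    using pBC hB hinj[OF that] by (auto simp: pairwise_def)
  then have "orthogonal_matrix ((\<chi> i j. h j $ i) :: real^'n^'n)"
    using n1[OF hB] by (simp add: orthogonal_matrix_orthonormal_columns column_def)
  moreover have "column i ((\<chi> i j. h j $ i) :: real^'n^'n) = f i" if "i \<in> I" for i
    using that by (simp add: column_def h_def vec_eq_iff)
  ultimately show ?thesis using that by blast
qed

text \<open>A nonnegative form that vanishes at \<open>v\<close> has no first-order term there.\<close>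

lemma nonneg_quadratic_linear_coeff:
  fixes a b :: real
  assumes "\<And>t. 0 \<le> 2 * t * a + t\<^sup>2 * b"
  shows "a = 0"
proof (rule ccontr)
  assume "a \<noteq> 0"
  \<comment> \<open>Since \<open>b \<le> c\<close>, the expression with \<open>c\<close> for
    \<open>b\<close> dominates; its minimum is at \<open>t = - a / c\<close>, with value
    \<open>- (a\<^sup>2 / c)\<close>. The added 1 keeps \<open>c\<close> positive.\<close>
  define c where "c = \<bar>b\<bar> + 1"
  have c: "c > 0" "b \<le> c" by (auto simp: c_def)
  have "0 \<le> 2 * (- a / c) * a + (- a / c)\<^sup>2 * b" by (rule assms)
  also have "\<dots> \<le> 2 * (- a / c) * a + (- a / c)\<^sup>2 * c"
    using c by (intro add_left_mono mult_left_mono) auto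
  also have "\<dots> = - (a\<^sup>2 / c)" using c by (simp add: field_simps power2_eq_square)
  also have "\<dots> < 0" using c \<open>a \<noteq> 0\<close> by simp
  finally show False by simp
qed

text \<open>Rayleigh's principle: a maximizer \<open>v\<close> of x . Ax on the unit sphere of
  \<open>T\<close> is an eigenvector. With \<open>l\<close> the maximum, l |x|^2 - x . Ax is
  nonnegative on \<open>T\<close> and vanishes at \<open>v\<close>, so its first-order term there is
  zero in every direction of \<open>T\<close>.\<close>

lemma symmetric_eigenvector:
  fixes A :: "real^'n^'n"
  assumes sym: "transpose A = A" and T: "subspace T" "T \<noteq> {0}"
    and inv: "\<And>x. x \<in> T \<Longrightarrow> A *v x \<in> T"
  obtains v l where "v \<in> T" "norm v = 1" "A *v v = l *\<^sub>R v"
proof -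
  let ?K = "T \<inter> sphere 0 1"
  have "compact ?K" using closed_subspace[OF T(1)] by (intro closed_Int_compact) auto
  moreover obtain u where u: "u \<in> T" "u \<noteq> 0" using T subspace_0 by auto
  have "u /\<^sub>R norm u \<in> ?K" using u T(1) by (simp add: subspace_scale)
  moreover have "continuous_on ?K (\<lambda>x. x \<bullet> (A *v x))"
    by (intro continuous_on_inner continuous_on_id matrix_vector_mult_linear_continuous_on)
  ultimately obtain v where v: "v \<in> ?K" and max: "\<And>x. x \<in> ?K \<Longrightarrow> x \<bullet> (A *v x) \<le> v \<bullet> (A *v v)"
    using continuous_attains_sup[of ?K "\<lambda>x. x \<bullet> (A *v x)"] by blast
  define l where "l = v \<bullet> (A *v v)"
  have vT: "v \<in> T" and nv: "v \<bullet> v = 1" using v by (auto simp: norm_eq_1)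
  have nn: "0 \<le> l * (x \<bullet> x) - x \<bullet> (A *v x)" if "x \<in> T" for x
  proof (cases "x = 0")
    case False
    have "x /\<^sub>R norm x \<in> ?K" using that False T(1) by (simp add: subspace_scale)
    then have "(x \<bullet> (A *v x)) / (norm x)\<^sup>2 \<le> l"
      using max[of "x /\<^sub>R norm x"] by (simp add: l_def matrix_vector_mult_scaleR power2_eq_square field_simps)
    then show ?thesis using False by (simp add: field_simps power2_norm_eq_inner)
  qed auto
  \<comment> \<open>The residual is the direction to test: it lies in \<open>T\<close> by
    invariance, and the first-order coefficient along it is 2 (w . w).\<close>
  define w where "w = l *\<^sub>R v - A *v v"
  have wT: "w \<in> T" unfolding w_def by (intro subspace_diff subspace_scale T inv vT)
  have "0 \<le> 2 * t * (w \<bullet> w) + t\<^sup>2 * (l * (w \<bullet> w) - w \<bullet> (A *v w))" for t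
  proof -
    have vAw: "v \<bullet> (A *v w) = (A *v v) \<bullet> w" by (simp add: inner_matrix_vector_right sym)
    have "v + t *\<^sub>R w \<in> T" by (intro subspace_add subspace_scale T vT wT)
    from nn[OF this] have "0 \<le> l * (v \<bullet> v) + 2 * t * l * (v \<bullet> w) + t\<^sup>2 * l * (w \<bullet> w)
      - (v \<bullet> (A *v v) + 2 * t * ((A *v v) \<bullet> w) + t\<^sup>2 * (w \<bullet> (A *v w)))"
      by (simp add: matrix_vector_right_distrib matrix_vector_mult_scaleR inner_add_left inner_add_right
          vAw inner_commute[of w v] inner_commute[of w "A *v v"] power2_eq_square algebra_simps)
    moreover have ww: "(A *v v) \<bullet> w = l * (v \<bullet> w) - w \<bullet> w"
      using arg_cong[OF w_def, of "\<lambda>z. z \<bullet> w"] by (simp add: inner_diff_left)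
    ultimately show ?thesis unfolding nv l_def[symmetric] ww by (simp add: algebra_simps)
  qed
  then have "w \<bullet> w = 0" by (rule nonneg_quadratic_linear_coeff)
  then have "A *v v = l *\<^sub>R v" by (simp add: w_def)
  then show ?thesis using that vT v by auto
qed

text \<open>A largest orthonormal set \<open>B\<close> of eigenvectors exists because independence
  bounds its size by the dimension. By symmetry its orthogonal complement \<open>T\<close> is
  invariant under \<open>A\<close>; if \<open>T\<close> were nonzero, an eigenvector inside it would
  enlarge \<open>B\<close>.\<close>

theorem spectral_theorem_symmetric:
  fixes A :: "real^'n^'n"
  assumes sym: "transpose A = A"
  obtains Q l where "orthogonal_matrix Q" "\<And>j. A *v column j Q = l j *\<^sub>R column j Q"
proof -
  define P where "P B \<longleftrightarrow> pairwise orthogonal B \<and> (\<forall>v\<in>B. norm v = 1 \<and> (\<exists>l. A *v v = l *\<^sub>R v))" for B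
  have ind: "independent B" if "P B" for B
    using that unfolding P_def by (intro pairwise_orthogonal_independent) auto
  have bound: "card B \<le> CARD('n)" if "P B" for B
    using independent_bound_general[OF ind[OF that]] dim_subset_UNIV[of B] by simp
  have "P {}" by (simp add: P_def)
  then obtain B where B: "P B" and Bmax: "\<And>C. P C \<Longrightarrow> card C \<le> card B"
    using ex_has_greatest_nat[of P "{}" card "Suc CARD('n)"] bound by (meson le_imp_less_Suc)
  have finB: "finite B" using ind[OF B] by (rule finiteI_independent)
  define T where "T = {x. \<forall>b\<in>B. orthogonal x b}"
  have sT: "subspace T" unfolding T_def by (auto simp: subspace_def orthogonal_clauses)
  have "A *v x \<in> T" if "x \<in> T" for x
    unfolding T_def
  proof (clarify)
    fix b assume "b \<in> B"
    then obtain l where "A *v b = l *\<^sub>R b" using B by (auto simp: P_def)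
    moreover have "x \<bullet> b = 0" using that \<open>b \<in> B\<close> by (simp add: T_def orthogonal_def)
    ultimately show "orthogonal (A *v x) b"
      by (simp add: orthogonal_def inner_matrix_vector_left sym)
  qed
  then have T0: "T = {0}"
  proof (rule_tac ccontr)
    assume *: "\<And>x. x \<in> T \<Longrightarrow> A *v x \<in> T" "T \<noteq> {0}"
    obtain v l where v: "v \<in> T" "norm v = 1" "A *v v = l *\<^sub>R v"
      using symmetric_eigenvector[OF sym sT *(2) *(1)] by metis
    have vB: "v \<notin> B" using v by (force simp: T_def orthogonal_self)
    have "P (insert v B)"
      using B v by (auto simp: P_def pairwise_insert T_def orthogonal_commute)
    from Bmax[OF this] show False using vB finB by simp
  qed
  have "span B = UNIV"
  proof -
    have "x \<in> span B" for x
    proof -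
      obtain y z where yz: "y \<in> span B" "\<And>w. w \<in> span B \<Longrightarrow> orthogonal z w" "x = y + z"
        using orthogonal_subspace_decomp_exists by blast
      have "z \<in> T" using yz(2) by (auto simp: T_def span_base)
      then show ?thesis using yz T0 by auto
    qed
    then show ?thesis by auto
  qed
  then have "card B = CARD('n)"
    by (rule card_basis[OF ind[OF B]])
  then obtain f where f: "bij_betw f (UNIV :: 'n set) B"
    using finite_same_card_bij[OF _ finB, of "UNIV :: 'n set"] by auto
  have fB: "f i \<in> B" for i using f by (auto simp: bij_betw_def)
  then have "f i \<bullet> f j = (if i = j then 1 else 0)" for i j
    using B bij_betw_imp_inj_on[OF f, THEN injD, of i j]
    by (cases "i = j") (auto simp: P_def pairwise_def orthogonal_def norm_eq_1)
  then obtain Q :: "real^'n^'n" where Q: "orthogonal_matrix Q" "\<And>i. column i Q = f i"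
    using orthogonal_matrix_extend[of UNIV f] by auto
  have "\<forall>j. \<exists>l. A *v column j Q = l *\<^sub>R column j Q"
    using B fB Q(2) by (auto simp: P_def)
  then show ?thesis using that Q(1) by metis
qed

subsection \<open>Positive definite matrices\<close>

lemma SPD_eigenvalues:
  assumes "A \<in> SPD"
  obtains Q l where "orthogonal_matrix Q" "\<And>j. A *v column j Q = l j *\<^sub>R column j Q" "\<And>j. 0 < l j"
proof -
  obtain Q l where Q: "orthogonal_matrix Q" "\<And>j. A *v column j Q = l j *\<^sub>R column j Q"
    using spectral_theorem_symmetric[of A] assms by (auto simp: SPD_def)
  have "0 < l j" for j
  proof -
    have n: "column j Q \<bullet> column j Q = 1" using column_inner_orthogonal_matrix[OF Q(1)] by simp
    then have "column j Q \<noteq> 0" by auto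
    then have "0 < column j Q \<bullet> (A *v column j Q)" using assms by (auto simp: SPD_def)
    then show ?thesis by (simp add: Q(2) n)
  qed
  then show ?thesis using that Q by blast
qed

text \<open>In the coordinates \<open>y = transpose Q *v v\<close> the quadratic form is the sum of
  l_j y_j^2.\<close>

lemma SPD_eigenvaluesI:
  fixes A :: "real^'n^'n"
  assumes "transpose A = A" and Q: "orthogonal_matrix Q" "\<And>j. A *v column j Q = l j *\<^sub>R column j Q"
    and l: "\<And>j. 0 < l j"
  shows "A \<in> SPD"
proof -
  have "0 < v \<bullet> (A *v v)" if "v \<noteq> 0" for v
  proof -
    define y where "y = transpose Q *v v"
    have v: "v = Q *v y" using Q(1) by (simp add: y_def matrix_vector_mul_assoc orthogonal_matrix_def)
    then have "y \<noteq> 0" using that by auto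
    then obtain i where i: "y $ i \<noteq> 0" by (auto simp: vec_eq_iff)
    have "v \<bullet> (A *v v) = y \<bullet> ((transpose Q ** A ** Q) *v y)"
      by (simp add: sandwich_inner v)
    also have "\<dots> = (\<Sum>j\<in>UNIV. l j * (y $ j)\<^sup>2)"
      by (simp add: diagonalized[OF Q] inner_vec_def matrix_vector_mult_def if_distrib if_distribR
          power2_eq_square algebra_simps cong: if_cong)
    also have "\<dots> > 0"
      by (rule sum_pos2[of _ i]) (use l i in \<open>auto simp: less_imp_le\<close>)
    finally show ?thesis .
  qed
  then show ?thesis using assms(1) by (auto simp: SPD_def)
qed

lemma SPD_det_pos: "A \<in> SPD \<Longrightarrow> 0 < det A"
  by (metis SPD_eigenvalues det_eq_prod_eigenvalues prod_pos)

lemma SPD_matrix_inv: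
  assumes "A \<in> SPD"
  shows "matrix_inv A \<in> SPD"
proof -
  have d: "det A \<noteq> 0" using SPD_det_pos[OF assms] by simp
  have sym: "transpose A = A" using assms by (simp add: SPD_def)
  have "A ** transpose (matrix_inv A) = transpose (matrix_inv A ** A)"
    by (simp add: matrix_transpose_mul sym)
  then have "transpose (matrix_inv A) = matrix_inv A"
    using matrix_inv_unique[of A "transpose (matrix_inv A)"] matrix_inv_left[OF d] by simp
  moreover have "0 < v \<bullet> (matrix_inv A *v v)" if "v \<noteq> 0" for v
  proof -
    define u where "u = matrix_inv A *v v"
    have v: "A *v u = v" by (simp add: u_def matrix_vector_mul_assoc matrix_inv_right[OF d])
    then have "u \<noteq> 0" using that by auto
    then have "0 < u \<bullet> (A *v u)" using assms by (auto simp: SPD_def)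
    then show ?thesis by (simp add: v u_def[symmetric] inner_commute)
  qed
  ultimately show ?thesis by (auto simp: SPD_def)
qed

lemma SPD_scaleR: "A \<in> SPD \<Longrightarrow> 0 < k \<Longrightarrow> k *\<^sub>R A \<in> SPD"
  by (auto simp: SPD_def transpose_scalar scaleR_matrix_vector_mult)

lemma symmetric_sandwich: "transpose A = A \<Longrightarrow> transpose (transpose V ** A ** V) = transpose V ** A ** V"
  for A :: "real^'n^'n"
  by (simp add: matrix_transpose_mul matrix_mul_assoc)

lemma SPD_sandwich:
  assumes "A \<in> SPD" "\<And>x. V *v x = 0 \<Longrightarrow> x = 0"
  shows "transpose V ** A ** V \<in> SPD"
  using assms by (auto simp: SPD_def symmetric_sandwich sandwich_inner)

text \<open>Take \<open>L = D ** transpose Q\<close>, where \<open>D\<close> holds the square roots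
  of the eigenvalues. This \<open>L\<close> need not be symmetric; a factorization is all that is
  required to symmetrize a product of two positive definite matrices.\<close>

lemma SPD_sqrt:
  fixes A :: "real^'n^'n"
  assumes "A \<in> SPD"
  obtains L :: "real^'n^'n" where "A = transpose L ** L"
proof -
  obtain Q l where Q: "orthogonal_matrix Q" "\<And>j. A *v column j Q = l j *\<^sub>R column j Q" "\<And>j. 0 < l j"
    using SPD_eigenvalues[OF assms] by metis
  define D where "D = (\<chi> i j. if i = j then sqrt (l i) else 0)"
  have "transpose D ** D = (\<chi> i j. if i = j then l i else 0)"
  proof -
    have "D $ k $ i * D $ k $ j = (if k = i then (if i = j then l i else 0) else 0)" for i j k
      using Q(3)[of i] by (auto simp: D_def)
    then show ?thesis by (simp add: matrix_matrix_mult_def transpose_def vec_eq_iff)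
  qed
  then have DD: "transpose D ** D = transpose Q ** A ** Q" using diagonalized[OF Q(1,2)] by simp
  have QQ: "Q ** transpose Q = mat 1" using Q(1) by (simp add: orthogonal_matrix_def)
  have "transpose (D ** transpose Q) ** (D ** transpose Q) = Q ** (transpose D ** D) ** transpose Q"
    by (simp add: matrix_transpose_mul matrix_mul_assoc)
  also have "\<dots> = (Q ** transpose Q) ** A ** (Q ** transpose Q)"
    unfolding DD by (simp add: matrix_mul_assoc)
  finally have "transpose (D ** transpose Q) ** (D ** transpose Q) = A" by (simp add: QQ)
  then show ?thesis using that by metis
qed

text \<open>Eigenvalue by eigenvalue this is ln l <= l - 1.\<close>

lemma SPD_ln_det_le:
  fixes A :: "real^'n^'n"
  assumes "A \<in> SPD"
  shows "ln (det A) \<le> trace A - CARD('n)"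
proof -
  obtain Q l where Q: "orthogonal_matrix Q" "\<And>j. A *v column j Q = l j *\<^sub>R column j Q" "\<And>j. 0 < l j"
    using SPD_eigenvalues[OF assms] by metis
  have "ln (det A) = (\<Sum>j\<in>UNIV. ln (l j))"
    using Q(3) by (simp add: det_eq_prod_eigenvalues[OF Q(1,2)] ln_prod less_imp_neq[symmetric])
  also have "\<dots> \<le> (\<Sum>j\<in>UNIV. l j - 1)"
    by (intro sum_mono ln_le_minus_one Q)
  also have "\<dots> = trace A - CARD('n)"
    by (simp add: trace_eq_sum_eigenvalues[OF Q(1,2)] sum_subtractf)
  finally show ?thesis .
qed

text \<open>\<open>P ** W\<close> is in general not symmetric, so \<open>SPD_ln_det_le\<close> does
  not apply to it. With P = L^T L the matrix L W L^T is positive definite and has the same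
  determinant and trace.\<close>

lemma SPD_ln_det_add_le:
  fixes P W :: "real^'n^'n"
  assumes P: "P \<in> SPD" and W: "W \<in> SPD"
  shows "ln (det P) + ln (det W) \<le> trace (P ** W) - CARD('n)"
proof -
  obtain L :: "real^'n^'n" where L: "P = transpose L ** L" using SPD_sqrt[OF P] by metis
  have dP: "det P = det L * det L" by (simp add: L det_mul)
  then have dL: "det (transpose L) \<noteq> 0" using SPD_det_pos[OF P] by auto
  have "L ** W ** transpose L \<in> SPD"
    using SPD_sandwich[OF W, of "transpose L"]
      by (metis dL matrix_inv_left matrix_vector_mul_assoc matrix_vector_mul_lid
          matrix_vector_mult_0_right transpose_transpose)
  from SPD_ln_det_le[OF this]
  have "ln (det (L ** W ** transpose L)) \<le> trace (L ** W ** transpose L) - CARD('n)" .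
  moreover have "det (L ** W ** transpose L) = det P * det W" by (simp add: det_mul dP)
  moreover have "trace ((L ** W) ** transpose L) = trace (P ** W)"
    by (subst trace_mul_sym) (simp add: L matrix_mul_assoc)
  ultimately show ?thesis
    using SPD_det_pos[OF P] SPD_det_pos[OF W] by (simp add: ln_mult_pos)
qed

subsection \<open>The Stiefel manifold\<close>

lemma transpose_mult_component: "(transpose A *v x) $ k = column k A \<bullet> (x :: real^'n)"
  by (simp add: matrix_vector_mult_def transpose_def column_def inner_vec_def)

lemma Stiefel_columns: "V \<in> Stiefel \<longleftrightarrow> (\<forall>i j. column i V \<bullet> column j V = (if i = j then 1 else 0))"
  by (simp add: Stiefel_def matrix_mult_transpose_dot_column vec_eq_iff mat_def)

lemma Stiefel_injective:
  assumes "V \<in> Stiefel" "V *v x = 0"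
  shows "x = 0"
proof -
  have "transpose V *v (V *v x) = x" using assms(1) by (simp add: Stiefel_def matrix_vector_mul_assoc)
  then show ?thesis using assms(2) by simp
qed

lemma Stiefel_mult_orthogonal:
  assumes "V \<in> Stiefel" "orthogonal_matrix A"
  shows "V ** A \<in> Stiefel"
proof -
  have "transpose (V ** A) ** (V ** A) = transpose A ** (transpose V ** V) ** A"
    by (simp add: matrix_transpose_mul matrix_mul_assoc)
  then show ?thesis using assms by (simp add: Stiefel_def orthogonal_matrix_def)
qed

lemma Stiefel_completion:
  fixes V :: "real^'d^'n" and e :: "'d \<Rightarrow> 'n"
  assumes "V \<in> Stiefel" "inj e"
  obtains Q :: "real^'n^'n" where "orthogonal_matrix Q" "\<And>j. column (e j) Q = column j V"
proof -
  obtain Q :: "real^'n^'n" where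
    Q: "orthogonal_matrix Q" "\<And>i. i \<in> range e \<Longrightarrow> column i Q = column (inv e i) V"
    using assms by (rule_tac orthogonal_matrix_extend[of "range e" "\<lambda>i. column (inv e i) V"])
      (auto simp: Stiefel_columns inj_eq)
  then show ?thesis using that[of Q] assms(2) by simp
qed

lemma obtain_inj:
  assumes "CARD('d::finite) \<le> CARD('n::finite)"
  obtains e :: "'d::finite \<Rightarrow> 'n::finite" where "inj e"
  using assms card_le_inj[of "UNIV :: 'd set" "UNIV :: 'n set"] by auto

text \<open>Complete the columns of \<open>V\<close> to an orthogonal \<open>Q\<close>, placing them
  at the positions \<open>range e\<close>. Then the trace of S is the sum of all diagonal entries of
  Q^T S Q, and the compression accounts for those at \<open>range e\<close>. This is what makes the
  argument of the first logarithm in \<open>G_learned\<close> positive.\<close>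

lemma trace_compression:
  fixes S :: "real^'n^'n" and V :: "real^'d^'n" and e :: "'d \<Rightarrow> 'n"
  assumes "V \<in> Stiefel" "inj e"
  obtains Q :: "real^'n^'n" where "orthogonal_matrix Q"
    "trace S - trace (transpose V ** S ** V) = (\<Sum>i\<in>- range e. column i Q \<bullet> (S *v column i Q))"
proof -
  obtain Q where Q: "orthogonal_matrix Q" "\<And>j. column (e j) Q = column j V"
    using Stiefel_completion[OF assms] by metis
  let ?g = "\<lambda>i. column i Q \<bullet> (S *v column i Q)"
  have "trace S = sum ?g UNIV"
    using trace_orthogonal_conj[OF Q(1), of S] by (simp add: trace_def sandwich_component)
  also have "\<dots> = sum ?g (range e) + sum ?g (- range e)"
    by (subst sum.union_disjoint[symmetric]) auto
  also have "sum ?g (range e) = trace (transpose V ** S ** V)"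
    by (simp add: sum.reindex[OF assms(2)] Q(2) trace_def sandwich_component)
  finally show ?thesis using that Q(1) by simp
qed

lemma trace_compression_less:
  fixes S :: "real^'n^'n" and V :: "real^'d^'n"
  assumes "CARD('d) < CARD('n)" "V \<in> Stiefel" "S \<in> SPD"
  shows "trace (transpose V ** S ** V) < trace S"
proof -
  obtain e :: "'d \<Rightarrow> 'n" where e: "inj e" using assms(1) obtain_inj less_imp_le by blast
  obtain Q :: "real^'n^'n" where Q: "orthogonal_matrix Q"
    "trace S - trace (transpose V ** S ** V) = (\<Sum>i\<in>- range e. column i Q \<bullet> (S *v column i Q))"
    using trace_compression[OF assms(2) e, of S] by metis
  have "card (range e) < CARD('n)" using assms(1) card_image[OF e] by simp
  then have "- range e \<noteq> {}" by (metis Compl_empty_eq double_compl less_irrefl)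
  moreover have "0 < column i Q \<bullet> (S *v column i Q)" for i
  proof -
    have "column i Q \<noteq> 0" using column_inner_orthogonal_matrix[OF Q(1), of i i] by auto
    then show ?thesis using assms(3) by (simp add: SPD_def)
  qed
  ultimately have "0 < (\<Sum>i\<in>- range e. column i Q \<bullet> (S *v column i Q))"
    by (intro sum_pos) auto
  then show ?thesis using Q(2) by simp
qed

subsection \<open>The precision matrix\<close>

definition precision :: "real^'d^'n \<Rightarrow> real^'d^'d \<Rightarrow> real \<Rightarrow> real^'n^'n" where
  "precision V \<Sigma> \<sigma> =
     (1 / \<sigma>\<^sup>2) *\<^sub>R (mat 1 - V ** transpose V) + V ** matrix_inv \<Sigma> ** transpose V"

text \<open>On the column space of \<open>V\<close> the projection term vanishes and the precision
  matrix acts as the inverse of \<Sigma> in the coordinates given by \<open>V\<close>, so the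
  columns of \<open>V ** A\<close> are eigenvectors. On the orthogonal complement only the factor 1
  / sigma^2 survives.\<close>

lemma precision_eigenvalues:
  fixes V :: "real^'d^'n" and e :: "'d \<Rightarrow> 'n"
  assumes V: "V \<in> Stiefel" and e: "inj e" and A: "orthogonal_matrix A"
    and eig: "\<And>j. matrix_inv \<Sigma> *v column j A = l j *\<^sub>R column j A"
  obtains Q where "orthogonal_matrix Q"
    "\<And>i. precision V \<Sigma> \<sigma> *v column i Q
        = (if i \<in> range e then l (inv e i) else 1 / \<sigma>\<^sup>2) *\<^sub>R column i Q"
proof -
  obtain Q where Q: "orthogonal_matrix Q" "\<And>j. column (e j) Q = column j (V ** A)"
    using Stiefel_completion[OF Stiefel_mult_orthogonal[OF V A] e] by metis
  have VV: "transpose V *v (V *v x) = x" for x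
    using V by (simp add: Stiefel_def matrix_vector_mul_assoc)
  have P: "precision V \<Sigma> \<sigma> *v x = (1 / \<sigma>\<^sup>2) *\<^sub>R (x - V *v (transpose V *v x))
      + V *v (matrix_inv \<Sigma> *v (transpose V *v x))" for x
    by (simp add: precision_def matrix_vector_mult_add_rdistrib matrix_vector_mult_diff_rdistrib
        scaleR_matrix_vector_mult matrix_vector_mul_assoc matrix_mul_assoc)
  have "precision V \<Sigma> \<sigma> *v column i Q = (if i \<in> range e then l (inv e i) else 1 / \<sigma>\<^sup>2) *\<^sub>R column i Q" for i
  proof (cases "i \<in> range e")
    case True
    then obtain j where j: "i = e j" by auto
    show ?thesis using e
      by (simp add: j Q(2) matrix_mult_column[symmetric] P VV eig matrix_vector_mult_scaleR)
  next
    case False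
    \<comment> \<open>Column \<open>i\<close> of \<open>Q\<close> is orthogonal to all columns of
      \<open>V ** A\<close>; as \<open>A\<close> is invertible, it is orthogonal to all columns of
      \<open>V\<close>.\<close>
    have "column k A \<bullet> (transpose V *v column i Q) = 0" for k
    proof -
      have "column (e k) Q \<bullet> column i Q = 0"
        using False column_inner_orthogonal_matrix[OF Q(1), of "e k" i] by auto
      then show ?thesis by (simp add: Q(2) matrix_mult_column[symmetric] inner_matrix_vector_left)
    qed
    then have "transpose A *v (transpose V *v column i Q) = 0"
      by (simp add: vec_eq_iff transpose_mult_component)
    then have "A *v (transpose A *v (transpose V *v column i Q)) = 0" by simp
    then have "transpose V *v column i Q = 0"
      using A unfolding orthogonal_matrix_def by (metis matrix_vector_mul_assoc matrix_vector_mul_lid)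
    then show ?thesis using False by (simp add: P)
  qed
  then show ?thesis using that Q(1) by blast
qed

lemma
  fixes V :: "real^'d^'n"
  assumes dim: "CARD('d) \<le> CARD('n)" and V: "V \<in> Stiefel" and \<Sigma>: "\<Sigma> \<in> SPD" and \<sigma>: "0 < \<sigma>"
  shows precision_SPD: "precision V \<Sigma> \<sigma> \<in> SPD"
    and det_precision: "det (precision V \<Sigma> \<sigma>) = (1 / \<sigma>\<^sup>2) ^ (CARD('n) - CARD('d)) / det \<Sigma>"
proof -
  obtain e :: "'d \<Rightarrow> 'n" where e: "inj e" using dim obtain_inj by blast
  obtain A l where A: "orthogonal_matrix A" "\<And>j. matrix_inv \<Sigma> *v column j A = l j *\<^sub>R column j A"
    "\<And>j. 0 < l j"
    using SPD_eigenvalues[OF SPD_matrix_inv[OF \<Sigma>]] by metis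
  define q where "q i = (if i \<in> range e then l (inv e i) else 1 / \<sigma>\<^sup>2)" for i
  obtain Q where Q: "orthogonal_matrix Q" "\<And>i. precision V \<Sigma> \<sigma> *v column i Q = q i *\<^sub>R column i Q"
    using precision_eigenvalues[OF V e A(1,2)] unfolding q_def by metis
  have "transpose (matrix_inv \<Sigma>) = matrix_inv \<Sigma>"
    using SPD_matrix_inv[OF \<Sigma>] by (simp add: SPD_def)
  then have "transpose (precision V \<Sigma> \<sigma>) = precision V \<Sigma> \<sigma>"
    by (simp add: precision_def transpose_add transpose_diff transpose_scalar matrix_transpose_mul matrix_mul_assoc)
  moreover have "0 < q i" for i using A(3) \<sigma> by (simp add: q_def)
  ultimately show "precision V \<Sigma> \<sigma> \<in> SPD" using SPD_eigenvaluesI Q by blast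
  have "det (precision V \<Sigma> \<sigma>) = prod q UNIV" by (rule det_eq_prod_eigenvalues[OF Q])
  also have "\<dots> = prod q (range e) * prod q (- range e)"
    by (subst prod.union_disjoint[symmetric]) auto
  also have "prod q (range e) = (\<Prod>j\<in>UNIV. l j)"
    using e by (simp add: prod.reindex q_def)
  also have "\<dots> = 1 / det \<Sigma>"
    using det_eq_prod_eigenvalues[OF A(1,2)] det_matrix_inv[of \<Sigma>] SPD_det_pos[OF \<Sigma>] by simp
  also have "prod q (- range e) = (1 / \<sigma>\<^sup>2) ^ (CARD('n) - CARD('d))"
    using card_image[OF e] by (simp add: q_def Compl_eq_Diff_UNIV card_Diff_subset)
  finally show "det (precision V \<Sigma> \<sigma>) = (1 / \<sigma>\<^sup>2) ^ (CARD('n) - CARD('d)) / det \<Sigma>" by simp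
qed

subsection \<open>The scatter matrix\<close>

text \<open>The weighted covariance identity: with m = alpha c, the two cross terms contribute -2
  alpha c c^T and the constant term alpha c c^T, which leaves C - alpha c c^T.\<close>

lemma scatter_centered:
  fixes x :: "nat \<Rightarrow> real^'n"
  assumes \<alpha>: "\<alpha> = weight_total \<beta> N" "\<alpha> \<noteq> 0" and c: "c = (1 / \<alpha>) *\<^sub>R first_moment x \<beta> N"
  shows "scatter x \<beta> N = (\<Sum>i=1..N. \<beta> i *\<^sub>R outer (x i - c) (x i - c))"
proof -
  have m: "first_moment x \<beta> N = \<alpha> *\<^sub>R c" using \<alpha>(2) c by simp
  have mc: "(\<Sum>i=1..N. \<beta> i * x i $ j) = \<alpha> * c $ j" for j
    using arg_cong[OF m, of "\<lambda>v. v $ j"] by (simp add: first_moment_def del: One_nat_def)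
  show ?thesis
  proof (simp only: vec_eq_iff, intro allI)
    fix j k
    have "(\<Sum>i=1..N. \<beta> i * ((x i $ j - c $ j) * (x i $ k - c $ k)))
      = (\<Sum>i=1..N. \<beta> i * (x i $ j * x i $ k)) - (\<Sum>i=1..N. \<beta> i * x i $ j) * c $ k
        - c $ j * (\<Sum>i=1..N. \<beta> i * x i $ k) + (\<Sum>i=1..N. \<beta> i) * (c $ j * c $ k)"
      by (simp add: sum_distrib_left sum_distrib_right sum_subtractf[symmetric] sum.distrib[symmetric] algebra_simps)
    also have "\<dots> = (\<Sum>i=1..N. \<beta> i * (x i $ j * x i $ k)) - \<alpha> * (c $ j * c $ k)"
      unfolding mc \<alpha>(1)[unfolded weight_total_def, symmetric] by simp
    also have "\<dots> = scatter x \<beta> N $ j $ k"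
      using \<alpha>(2) by (simp add: scatter_def m second_moment_def outer_def \<alpha>(1)[symmetric])
    finally show "scatter x \<beta> N $ j $ k = (\<Sum>i=1..N. \<beta> i *\<^sub>R outer (x i - c) (x i - c)) $ j $ k"
      by (simp add: outer_def)
  qed
qed

text \<open>Split x_i - nu into (x_i - c) + (c - nu). The mixed terms cancel because the weighted
  deviations from \<open>c\<close> sum to zero, and y . Py is the trace of P y y^T. Thus \<nu> is
  separated from the data.\<close>

lemma weighted_quadratic:
  fixes x :: "nat \<Rightarrow> real^'n"
  assumes \<alpha>: "\<alpha> = weight_total \<beta> N" "\<alpha> \<noteq> 0" and c: "c = (1 / \<alpha>) *\<^sub>R first_moment x \<beta> N"
    and P: "transpose P = P"
  shows "(\<Sum>i=1..N. \<beta> i * ((x i - \<nu>) \<bullet> (P *v (x i - \<nu>))))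
    = trace (P ** scatter x \<beta> N) + \<alpha> * ((c - \<nu>) \<bullet> (P *v (c - \<nu>)))"
proof -
  have z: "(\<Sum>i=1..N. \<beta> i *\<^sub>R (x i - c)) = 0"
  proof -
    have "(\<Sum>i=1..N. \<beta> i *\<^sub>R (x i - c)) = first_moment x \<beta> N - weight_total \<beta> N *\<^sub>R c"
      unfolding first_moment_def weight_total_def by (simp only: scaleR_diff_right sum_subtractf scaleR_sum_left)
    then show ?thesis using \<alpha>(2) by (simp add: c flip: \<alpha>(1))
  qed
  have "(x i - \<nu>) \<bullet> (P *v (x i - \<nu>)) = (x i - c) \<bullet> (P *v (x i - c))
      + 2 * ((x i - c) \<bullet> (P *v (c - \<nu>))) + (c - \<nu>) \<bullet> (P *v (c - \<nu>))" for i
  proof -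
    have e: "x i - \<nu> = (x i - c) + (c - \<nu>)" by simp
    have s: "(c - \<nu>) \<bullet> (P *v (x i - c)) = (x i - c) \<bullet> (P *v (c - \<nu>))"
      using inner_matrix_vector_right[of "c - \<nu>" P "x i - c"] P by (simp add: inner_commute)
    show ?thesis unfolding e matrix_vector_right_distrib inner_add_left inner_add_right s by simp
  qed
  then have "(\<Sum>i=1..N. \<beta> i * ((x i - \<nu>) \<bullet> (P *v (x i - \<nu>))))
     = (\<Sum>i=1..N. \<beta> i * ((x i - c) \<bullet> (P *v (x i - c))))
       + 2 * ((\<Sum>i=1..N. \<beta> i *\<^sub>R (x i - c)) \<bullet> (P *v (c - \<nu>)))
       + (\<Sum>i=1..N. \<beta> i) * ((c - \<nu>) \<bullet> (P *v (c - \<nu>)))"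
    by (simp add: distrib_left sum.distrib inner_sum_left sum_distrib_left sum_distrib_right mult.left_commute)
  also have "(\<Sum>i=1..N. \<beta> i * ((x i - c) \<bullet> (P *v (x i - c)))) = trace (P ** scatter x \<beta> N)"
    by (simp add: scatter_centered[OF \<alpha> c] matrix_mult_sum_right trace_sum scaleR_matrix_mult_right
        trace_scaleR outer_eq_outer_product matrix_mult_outer_product trace_outer_product inner_commute)
  finally show ?thesis using \<alpha>(1) by (simp add: z weight_total_def del: One_nat_def)
qed

lemma scatter_symmetric: "transpose (scatter x \<beta> N) = scatter x \<beta> N"
  by (simp add: scatter_def second_moment_def outer_def transpose_def vec_eq_iff mult.commute)

lemma scatter_quadratic:
  fixes x :: "nat \<Rightarrow> real^'n"
  assumes \<alpha>: "\<alpha> = weight_total \<beta> N" "\<alpha> \<noteq> 0" and c: "c = (1 / \<alpha>) *\<^sub>R first_moment x \<beta> N"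
  shows "v \<bullet> (scatter x \<beta> N *v v) = (\<Sum>i=1..N. \<beta> i * ((x i - c) \<bullet> v)\<^sup>2)"
proof -
  have mv: "(\<Sum>i\<in>I. f i) *v v = (\<Sum>i\<in>I. f i *v v)" for I and f :: "nat \<Rightarrow> real^'n^'n"
    by (induction I rule: infinite_finite_induct) (auto simp: matrix_vector_mult_add_rdistrib)
  show ?thesis
    by (simp add: scatter_centered[OF assms] mv inner_sum_right scaleR_matrix_vector_mult
        outer_eq_outer_product outer_product_vector_mult power2_eq_square inner_commute mult.assoc)
qed

lemma scatter_nonneg:
  fixes x :: "nat \<Rightarrow> real^'n"
  assumes \<alpha>: "\<alpha> = weight_total \<beta> N" "\<alpha> \<noteq> 0" and weights: "\<forall>i\<in>{1..N}. 0 \<le> \<beta> i"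
  shows "0 \<le> v \<bullet> (scatter x \<beta> N *v v)"
  unfolding scatter_quadratic[OF \<alpha> refl] using weights by (intro sum_nonneg) auto

text \<open>n + 1 affinely independent points have affine dimension n, whereas a proper hyperplane
  has only n - 1.\<close>

lemma affinely_independent_not_in_hyperplane:
  fixes x :: "nat \<Rightarrow> real^'n"
  assumes "affinely_independent_points x I" and "\<forall>i\<in>I. x i \<bullet> v = r"
  shows "v = 0"
proof (rule ccontr)
  assume v: "v \<noteq> 0"
  obtain K where K: "K \<subseteq> I" "card K = CARD('n) + 1" "inj_on x K" "\<not> affine_dependent (x ` K)"
    using assms(1) by (auto simp: affinely_independent_points_def)
  have "aff_dim (x ` K) = CARD('n)"
    using aff_dim_affine_independent[OF K(4)] K(2) card_image[OF K(3)] by simp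
  moreover have "x ` K \<subseteq> {y. v \<bullet> y = r}"
    using K(1) assms(2) by (auto simp: inner_commute)
  then have "aff_dim (x ` K) \<le> aff_dim {y. v \<bullet> y = r}" by (rule aff_dim_subset)
  ultimately show False using v by simp
qed

text \<open>If v . Sv = 0, every summand \<beta>_i ((x_i - c) . v)^2 vanishes, which puts all points
  of positive weight on one level set of x . v.\<close>

lemma scatter_SPD:
  fixes x :: "nat \<Rightarrow> real^'n"
  assumes \<alpha>: "\<alpha> = weight_total \<beta> N" "\<alpha> \<noteq> 0" and weights: "\<forall>i\<in>{1..N}. 0 \<le> \<beta> i"
    and points: "affinely_independent_points x {i\<in>{1..N}. 0 < \<beta> i}"
  shows "scatter x \<beta> N \<in> SPD"
proof -
  define c where "c = (1 / \<alpha>) *\<^sub>R first_moment x \<beta> N"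
  have "v = 0" if "v \<bullet> (scatter x \<beta> N *v v) = 0" for v
  proof -
    have "(\<Sum>i=1..N. \<beta> i * ((x i - c) \<bullet> v)\<^sup>2) = 0"
      using that scatter_quadratic[OF \<alpha> c_def] by simp
    then have "\<forall>i\<in>{1..N}. \<beta> i * ((x i - c) \<bullet> v)\<^sup>2 = 0"
      using weights by (subst (asm) sum_nonneg_eq_0_iff) auto
    then have "\<forall>i\<in>{i\<in>{1..N}. 0 < \<beta> i}. x i \<bullet> v = c \<bullet> v"
      by (force simp: inner_diff_left)
    then show ?thesis by (rule affinely_independent_not_in_hyperplane[OF points])
  qed
  then show ?thesis
    using scatter_nonneg[OF \<alpha> weights] scatter_symmetric by (force simp: SPD_def less_le)
qed

subsection \<open>The objective function\<close>

lemma ln_gaussian_density: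
  fixes P :: "real^'n^'n"
  assumes "P \<in> SPD"
  shows "ln (gaussian_density x \<nu> (matrix_inv P))
    = - (real CARD('n) / 2) * ln (2 * pi) + ln (det P) / 2 - ((x - \<nu>) \<bullet> (P *v (x - \<nu>))) / 2"
proof -
  have d: "det P > 0" by (rule SPD_det_pos[OF assms])
  have d': "det (matrix_inv P) > 0" by (rule SPD_det_pos[OF SPD_matrix_inv[OF assms]])
  have "ln (det (matrix_inv P)) = - ln (det P)"
    using d by (simp add: det_matrix_inv ln_div)
  then show ?thesis
    using d d' by (simp add: gaussian_density_def matrix_inv_involution ln_mult_pos ln_powr)
qed

lemma trace_precision_mult:
  "trace (precision V \<Sigma> \<sigma> ** S) = (1 / \<sigma>\<^sup>2) * (trace S - trace (transpose V ** S ** V))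
     + trace (matrix_inv \<Sigma> ** (transpose V ** S ** V))"
proof -
  have 1: "trace (V ** transpose V ** S) = trace (transpose V ** S ** V)"
    using trace_mul_sym[of V "transpose V ** S"] by (simp add: matrix_mul_assoc)
  have 2: "trace (V ** matrix_inv \<Sigma> ** transpose V ** S) = trace (matrix_inv \<Sigma> ** (transpose V ** S ** V))"
    using trace_mul_sym[of V "matrix_inv \<Sigma> ** transpose V ** S"] by (simp add: matrix_mul_assoc)
  have "precision V \<Sigma> \<sigma> ** S = (1 / \<sigma>\<^sup>2) *\<^sub>R (S - V ** transpose V ** S)
      + V ** matrix_inv \<Sigma> ** transpose V ** S"
    by (simp only: precision_def matrix_add_rdistrib scaleR_matrix_mult_left matrix_diff_rdistrib matrix_mul_lid)
  then show ?thesis by (simp only: trace_add trace_sub trace_scaleR 1 2)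
qed

text \<open>Both \<open>b\<close> and \<open>\<mu>\<close> enter only through \<open>\<nu>\<close>,
  in the last summand. They are redundant as parameters: every pair with \<nu> = c is optimal, and
  \<mu> = 0, b = c is the simplest one.\<close>

lemma J_eq:
  fixes x :: "nat \<Rightarrow> real^'n" and V :: "real^'d^'n"
  assumes dim: "CARD('d) < CARD('n)"
    and \<alpha>: "\<alpha> = weight_total \<beta> N" "\<alpha> \<noteq> 0" and c: "c = (1 / \<alpha>) *\<^sub>R first_moment x \<beta> N"
    and S: "S = scatter x \<beta> N"
    and V: "V \<in> Stiefel" and \<Sigma>: "\<Sigma> \<in> SPD" and \<sigma>: "0 < \<sigma>"
    and \<nu>: "\<nu> = mu_tilde V b \<mu> \<Sigma> \<sigma>"
  shows "J x \<beta> N V b \<mu> \<Sigma> \<sigma> = - (\<alpha> * real CARD('n) / 2) * ln (2 * pi)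
     - (\<alpha> * ((real CARD('n) - real CARD('d)) * ln (\<sigma>\<^sup>2) + ln (det \<Sigma>))
        + (trace S - trace (transpose V ** S ** V)) / \<sigma>\<^sup>2
        + trace (matrix_inv \<Sigma> ** (transpose V ** S ** V))
        + \<alpha> * ((c - \<nu>) \<bullet> (precision V \<Sigma> \<sigma> *v (c - \<nu>)))) / 2"
proof -
  let ?P = "precision V \<Sigma> \<sigma>"
  have P: "?P \<in> SPD" using precision_SPD[OF _ V \<Sigma> \<sigma>] dim by simp
  have sym: "transpose ?P = ?P" using P by (simp add: SPD_def)
  have "ln (det ?P) = - (real CARD('n) - real CARD('d)) * ln (\<sigma>\<^sup>2) - ln (det \<Sigma>)"
  proof -
    have s: "0 < \<sigma>\<^sup>2" using \<sigma> by simp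
    have "ln (det ?P) = real (CARD('n) - CARD('d)) * ln (1 / \<sigma>\<^sup>2) - ln (det \<Sigma>)"
      unfolding det_precision[OF less_imp_le[OF dim] V \<Sigma> \<sigma>]
      using s SPD_det_pos[OF \<Sigma>] by (subst ln_div) (auto simp del: power_one_over simp: ln_realpow)
    also have "ln (1 / \<sigma>\<^sup>2) = - ln (\<sigma>\<^sup>2)" using s by (subst ln_div) auto
    finally show ?thesis using dim by (simp only: of_nat_diff less_imp_le mult_minus_left mult_minus_right)
  qed
  note lnP = this
  have St: "Sigma_tilde V \<Sigma> \<sigma> = matrix_inv ?P" by (simp only: Sigma_tilde_def precision_def)
  have "J x \<beta> N V b \<mu> \<Sigma> \<sigma>
    = (\<Sum>i=1..N. \<beta> i * (- (real CARD('n) / 2) * ln (2 * pi) + ln (det ?P) / 2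
         - ((x i - \<nu>) \<bullet> (?P *v (x i - \<nu>))) / 2))"
    by (simp only: J_def St \<nu>[symmetric] ln_gaussian_density[OF P])
  also have "\<dots> = \<alpha> * (- (real CARD('n) / 2) * ln (2 * pi) + ln (det ?P) / 2)
      - (\<Sum>i=1..N. \<beta> i * ((x i - \<nu>) \<bullet> (?P *v (x i - \<nu>)))) / 2"
    unfolding \<alpha>(1) weight_total_def
    by (simp only: right_diff_distrib sum_subtractf sum_distrib_right sum_divide_distrib times_divide_eq_right)
  also have "(\<Sum>i=1..N. \<beta> i * ((x i - \<nu>) \<bullet> (?P *v (x i - \<nu>))))
      = (trace S - trace (transpose V ** S ** V)) / \<sigma>\<^sup>2
        + trace (matrix_inv \<Sigma> ** (transpose V ** S ** V)) + \<alpha> * ((c - \<nu>) \<bullet> (?P *v (c - \<nu>)))"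
    unfolding weighted_quadratic[OF \<alpha> c sym] S[symmetric] trace_precision_mult by simp
  finally have J: "J x \<beta> N V b \<mu> \<Sigma> \<sigma> =
      \<alpha> * (- (real CARD('n) / 2) * ln (2 * pi) + ln (det ?P) / 2)
      - ((trace S - trace (transpose V ** S ** V)) / \<sigma>\<^sup>2
        + trace (matrix_inv \<Sigma> ** (transpose V ** S ** V)) + \<alpha> * ((c - \<nu>) \<bullet> (?P *v (c - \<nu>)))) / 2" .
  have arith: "a * (- (n / 2) * L + (- (n - d) * s - D) / 2) - (T + t + a * q) / 2
      = - (a * n / 2) * L - (a * ((n - d) * s + D) + T + t + a * q) / 2" for a n L d s D T t q :: real
    by (simp add: field_simps)
  show ?thesis unfolding J lnP by (rule arith)
qed

text \<open>\<open>M\<close> is the maximum of J over \<open>b\<close>, \<open>\<mu>\<close> and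
  \<open>\<Sigma>\<close> with \<open>V\<close> and \<open>\<sigma>\<close> frozen. Its constants
  come from W = B / alpha with B = V^T S V: ln det W = ln det B - d ln alpha, and the log-det
  inequality contributes d. At \<Sigma> = W that inequality is sharp, because the trace of W^-1 B is
  alpha d, and \<mu> = 0 makes the mean equal to c.\<close>

lemma
  fixes x :: "nat \<Rightarrow> real^'n" and V :: "real^'d^'n"
  assumes dim: "CARD('d) < CARD('n)"
    and \<alpha>: "\<alpha> = weight_total \<beta> N" "0 < \<alpha>" and m: "m = first_moment x \<beta> N"
    and S: "S = scatter x \<beta> N"
    and V: "V \<in> Stiefel" and B: "transpose V ** S ** V \<in> SPD" and \<sigma>: "0 < \<sigma>"
  defines "M \<equiv> - (\<alpha> * real CARD('n) / 2) * ln (2 * pi)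
     - (\<alpha> * ((real CARD('n) - real CARD('d)) * ln (\<sigma>\<^sup>2) + CARD('d) - CARD('d) * ln \<alpha>)
        + trace S / \<sigma>\<^sup>2 + G_fixed S \<alpha> \<sigma> V) / 2"
  shows J_le_G_fixed: "\<Sigma> \<in> SPD \<Longrightarrow> J x \<beta> N V b \<mu> \<Sigma> \<sigma> \<le> M"
    and J_eq_G_fixed: "J x \<beta> N V ((1 / \<alpha>) *\<^sub>R m) 0 ((1 / \<alpha>) *\<^sub>R (transpose V ** S ** V)) \<sigma> = M"
proof -
  let ?B = "transpose V ** S ** V" and ?c = "(1 / \<alpha>) *\<^sub>R first_moment x \<beta> N"
  have \<alpha>0: "\<alpha> \<noteq> 0" using \<alpha>(2) by simp
  note J = J_eq[OF dim \<alpha>(1) \<alpha>0 refl S V _ \<sigma> refl]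
  have W: "(1 / \<alpha>) *\<^sub>R ?B \<in> SPD" using SPD_scaleR[OF B] \<alpha>(2) by simp
  have "det (k *\<^sub>R A) = k ^ CARD('d) * det A" for k and A :: "real^'d^'d"
  proof -
    have "k *\<^sub>R A = (\<chi> i. k *s A $ i)" by (simp add: vec_eq_iff)
    then show ?thesis using det_rows_mul[of "\<lambda>_. k" "\<lambda>i. A $ i"] by simp
  qed
  then have lnW: "ln (det ((1 / \<alpha>) *\<^sub>R ?B)) = ln (det ?B) - CARD('d) * ln \<alpha>"
    using \<alpha>(2) SPD_det_pos[OF B] by (simp add: ln_mult_pos ln_realpow ln_div)
  {
    assume \<Sigma>: "\<Sigma> \<in> SPD"
    let ?\<nu> = "mu_tilde V b \<mu> \<Sigma> \<sigma>"
    have "0 \<le> (?c - ?\<nu>) \<bullet> (precision V \<Sigma> \<sigma> *v (?c - ?\<nu>))"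
      using precision_SPD[OF _ V \<Sigma> \<sigma>] dim by (cases "?c = ?\<nu>") (auto simp: SPD_def less_imp_le)
    then have 1: "0 \<le> \<alpha> * ((?c - ?\<nu>) \<bullet> (precision V \<Sigma> \<sigma> *v (?c - ?\<nu>)))"
      using \<alpha>(2) by simp
    have "- ln (det \<Sigma>) + (ln (det ?B) - CARD('d) * ln \<alpha>)
        \<le> (1 / \<alpha>) * trace (matrix_inv \<Sigma> ** ?B) - CARD('d)"
      using SPD_ln_det_add_le[OF SPD_matrix_inv[OF \<Sigma>] W] SPD_det_pos[OF \<Sigma>]
      by (simp add: lnW det_matrix_inv ln_div scaleR_matrix_mult_right trace_scaleR)
    then have "\<alpha> * (- ln (det \<Sigma>) + (ln (det ?B) - CARD('d) * ln \<alpha>))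
        \<le> \<alpha> * ((1 / \<alpha>) * trace (matrix_inv \<Sigma> ** ?B) - CARD('d))"
      using \<alpha>(2) by (intro mult_left_mono) auto
    then show "J x \<beta> N V b \<mu> \<Sigma> \<sigma> \<le> M"
      using 1 \<alpha>(2) unfolding J[OF \<Sigma>] M_def G_fixed_def
      by (simp add: right_diff_distrib distrib_left diff_divide_distrib)
  next
    have "matrix_inv ((1 / \<alpha>) *\<^sub>R ?B) = \<alpha> *\<^sub>R matrix_inv ?B"
      using \<alpha>(2) SPD_det_pos[OF B]
      by (intro matrix_inv_unique) (simp add: scaleR_matrix_mult_left scaleR_matrix_mult_right matrix_inv_right)
    then have t: "trace (matrix_inv ((1 / \<alpha>) *\<^sub>R ?B) ** ?B) = \<alpha> * CARD('d)"
      using SPD_det_pos[OF B] by (simp add: scaleR_matrix_mult_left matrix_inv_left trace_scaleR trace_I)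
    have "mu_tilde V ((1 / \<alpha>) *\<^sub>R m) 0 ((1 / \<alpha>) *\<^sub>R ?B) \<sigma> = ?c"
      by (simp add: mu_tilde_def m)
    then show "J x \<beta> N V ((1 / \<alpha>) *\<^sub>R m) 0 ((1 / \<alpha>) *\<^sub>R ?B) \<sigma> = M"
      unfolding J[OF W] lnW t M_def G_fixed_def
      by (simp add: right_diff_distrib distrib_left diff_divide_distrib add_divide_distrib)
  }
qed

subsection \<open>Degenerate scatter matrices\<close>

text \<open>The form attains its minimum 0 at \<open>w\<close>, so its first-order term there
  vanishes; in the direction \<open>z = S *v w\<close> that term is 2 (z . z).\<close>

lemma nonneg_form_kernel:
  fixes S :: "real^'n^'n"
  assumes sym: "transpose S = S" and psd: "\<And>v. 0 \<le> v \<bullet> (S *v v)" and w: "w \<bullet> (S *v w) = 0"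
  shows "S *v w = 0"
proof -
  define z where "z = S *v w"
  have "0 \<le> 2 * t * (z \<bullet> z) + t\<^sup>2 * (z \<bullet> (S *v z))" for t
  proof -
    have "w \<bullet> (S *v z) = z \<bullet> z"
      using inner_matrix_vector_right[of w S z] by (simp add: sym z_def)
    then have "(w + t *\<^sub>R z) \<bullet> (S *v (w + t *\<^sub>R z)) = 2 * t * (z \<bullet> z) + t\<^sup>2 * (z \<bullet> (S *v z))"
      using w by (simp add: matrix_vector_right_distrib matrix_vector_mult_scaleR inner_add_left
          inner_add_right z_def[symmetric] power2_eq_square algebra_simps)
    then show ?thesis using psd[of "w + t *\<^sub>R z"] by simp
  qed
  then have "z \<bullet> z = 0" by (rule nonneg_quadratic_linear_coeff)
  then show ?thesis by (simp add: z_def)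
qed

text \<open>An orthonormal basis containing \<open>a\<close> consists of eigenvectors, with
  eigenvalue 1 + k for \<open>a\<close> and 1 otherwise. Here \<open>undefined\<close> is just some
  fixed index at which \<open>a\<close> is placed.\<close>

lemma det_rank_one_update:
  fixes a :: "real^'n"
  assumes "norm a = 1"
  shows "det (mat 1 + k *\<^sub>R outer_product a a) = 1 + k"
proof -
  obtain Q where Q: "orthogonal_matrix Q" "Q *v axis undefined 1 = a"
    using orthogonal_matrix_exists_basis[OF assms] by metis
  have a: "column undefined Q = a" using Q(2) by (simp add: matrix_vector_mult_basis)
  define l where "l j = (if j = undefined then 1 + k else 1)" for j :: 'n
  have "(mat 1 + k *\<^sub>R outer_product a a) *v column j Q = l j *\<^sub>R column j Q" for j
    using column_inner_orthogonal_matrix[OF Q(1), of undefined j]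
    by (auto simp: matrix_vector_mult_add_rdistrib scaleR_matrix_vector_mult outer_product_vector_mult a l_def
        scaleR_add_left)
  then have "det (mat 1 + k *\<^sub>R outer_product a a) = (\<Prod>j\<in>UNIV. l j)"
    by (rule det_eq_prod_eigenvalues[OF Q(1)])
  then show ?thesis by (simp add: l_def)
qed

lemma trace_sandwich_nonneg:
  fixes S :: "real^'n^'n" and V :: "real^'d^'n"
  assumes "\<And>v. 0 \<le> v \<bullet> (S *v v)"
  shows "0 \<le> trace (transpose V ** S ** V)"
  unfolding trace_def sandwich_component by (intro sum_nonneg assms)

text \<open>Some unit vector in the column space of \<open>U\<close> is rotated towards the kernel vector \<open>w\<close>; the
  angle is chosen such that the compression of \<open>S\<close> is multiplied on both sides by a
  rank-one update of the identity with determinant \<open>\<delta>\<close>.\<close>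

lemma Stiefel_rotate_towards_kernel:
  fixes U :: "real^'d^'n" and S :: "real^'n^'n"
  assumes U: "U \<in> Stiefel" and sym: "transpose S = S" and psd: "\<And>v. 0 \<le> v \<bullet> (S *v v)"
    and w: "w \<noteq> 0" "S *v w = 0" and det: "det (transpose U ** S ** U) \<noteq> 0" and \<delta>: "0 < \<delta>" "\<delta> \<le> 1"
  obtains V :: "real^'d^'n" where "V \<in> Stiefel"
    "det (transpose V ** S ** V) = \<delta>\<^sup>2 * det (transpose U ** S ** U)"
    "trace (transpose V ** S ** V) \<le> trace (transpose U ** S ** U)"
proof -
  let ?B = "transpose U ** S ** U"
  define w1 where "w1 = w /\<^sub>R norm w"
  have "norm w1 = 1" using w(1) by (simp add: w1_def)
  then have w1: "w1 \<bullet> w1 = 1" "S *v w1 = 0"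
    using w(2) by (simp_all only: norm_eq_1) (simp add: w1_def matrix_vector_mult_scaleR)
  have UU: "transpose U *v (U *v y) = y" for y
    using U by (simp add: Stiefel_def matrix_vector_mul_assoc)
  \<comment> \<open>The unit kernel vector is decomposed as w1 = U a + r, with \<open>r\<close>
    orthogonal to the column space of \<open>U\<close>.\<close>
  define a where "a = transpose U *v w1"
  define r where "r = w1 - U *v a"
  have Ur: "transpose U *v r = 0" by (simp add: r_def matrix_vector_mult_diff_distrib UU a_def)
  define \<rho> where "\<rho> = norm r"
  have "r \<noteq> 0"
  proof
    assume "r = 0"
    then have w1a: "w1 = U *v a" by (simp add: r_def)
    then have "?B *v a = 0" using w1(2) by (simp add: matrix_vector_mul_assoc[symmetric])
    then have "a = 0" using matrix_inv_left[OF det]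
      by (metis matrix_vector_mul_assoc matrix_vector_mul_lid matrix_vector_mult_0_right)
    then show False using w1a w1(1) by simp
  qed
  then have \<rho>: "0 < \<rho>" by (simp add: \<rho>_def)
  \<comment> \<open>\<open>U *v h\<close> is the unit vector to be rotated. If w1 is orthogonal to
    the column space, then a = 0 and any unit vector \<open>h\<close> will do, with s = 0.\<close>
  obtain h s where h: "norm h = 1" "a = s *\<^sub>R h"
  proof (cases "a = 0")
    case True
    then show ?thesis using that[of "axis undefined 1" 0] by simp
  next
    case False
    then show ?thesis using that[of "a /\<^sub>R norm a" "norm a"] by simp
  qed
  have hh: "h \<bullet> h = 1" using h(1) by (simp add: norm_eq_1)
  define z where "z = r /\<^sub>R \<rho>"
  have "norm z = 1" using \<rho> by (simp add: z_def \<rho>_def)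
  then have zz: "z \<bullet> z = 1" by (simp only: norm_eq_1)
  have Uz: "transpose U *v z = 0" by (simp add: z_def matrix_vector_mult_scaleR Ur)
  have rr: "r \<bullet> r = \<rho>\<^sup>2" by (simp add: \<rho>_def power2_norm_eq_inner)
  have "w1 \<bullet> w1 = s\<^sup>2 + \<rho>\<^sup>2"
  proof -
    have "w1 = U *v a + r" by (simp add: r_def)
    moreover have "(U *v a) \<bullet> (U *v a) = s\<^sup>2"
      by (simp add: inner_matrix_vector_left UU h(2) hh power2_eq_square)
    moreover have "(U *v a) \<bullet> r = 0" by (simp add: inner_matrix_vector_left Ur)
    ultimately show ?thesis by (simp add: inner_add_left inner_add_right rr inner_commute)
  qed
  then have s\<rho>: "s\<^sup>2 + \<rho>\<^sup>2 = 1" using w1(1) by simp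
  \<comment> \<open>Since w1 = s U h + \<rho> z is annihilated by S, the image of the new direction
    \<open>z\<close> is a multiple of that of \<open>U *v h\<close>.\<close>
  have Sz: "S *v z = - (s / \<rho>) *\<^sub>R (S *v (U *v h))"
    using w1(2) by (simp add: z_def r_def h(2) matrix_vector_mult_scaleR matrix_vector_mult_diff_distrib divide_inverse)
  have "\<rho>\<^sup>2 \<le> 1" using s\<rho> zero_le_power2[of s] by linarith
  then have "\<rho> \<le> 1" by (simp add: abs_square_le_1)
  then have "\<rho> * \<delta> \<le> 1" using \<delta> \<rho> by (simp add: mult_le_one)
  then have \<rho>\<delta>: "(\<rho> * \<delta>)\<^sup>2 \<le> 1" using \<delta> \<rho> by (simp add: power_le_one)
  define \<kappa> where "\<kappa> = sqrt (1 - (\<rho> * \<delta>)\<^sup>2)"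
  have \<kappa>: "\<kappa>\<^sup>2 = 1 - (\<rho> * \<delta>)\<^sup>2" using \<rho>\<delta> by (simp add: \<kappa>_def)
  \<comment> \<open>In the plane with orthonormal basis U h, z, the vector w1 is (s, \<rho>), and
    (p, q) = \<kappa> (s, \<rho>) + \<rho> \<delta> (\<rho>, -s). S kills the first part and sends
    (\<rho>, -s) to S U h / \<rho>, so the rotated vector has image \<delta> S U h;
    \<open>\<kappa>\<close> makes its length 1.\<close>
  define p where "p = s * \<kappa> + \<rho>\<^sup>2 * \<delta>"
  define q where "q = \<rho> * \<kappa> - s * \<rho> * \<delta>"
  have "p\<^sup>2 + q\<^sup>2 = (s\<^sup>2 + \<rho>\<^sup>2) * (\<kappa>\<^sup>2 + (\<rho> * \<delta>)\<^sup>2)"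
    unfolding p_def q_def by algebra
  then have pq: "p\<^sup>2 + q\<^sup>2 = 1" using s\<rho> \<kappa> by simp
  have "q * (s / \<rho>) = s * \<kappa> - s\<^sup>2 * \<delta>"
    using \<rho> by (simp add: q_def field_simps power2_eq_square)
  moreover have "\<rho>\<^sup>2 * \<delta> + s\<^sup>2 * \<delta> = \<delta>" using s\<rho> by (metis add.commute distrib_right mult_1)
  ultimately have pqs: "p - q * (s / \<rho>) = \<delta>" by (simp add: p_def)
  \<comment> \<open>\<open>V\<close> agrees with \<open>U\<close> on the orthogonal complement of
    \<open>h\<close> and sends \<open>h\<close> to p U h + q z. Its product with S is S U M, where
    \<open>M\<close> scales \<open>h\<close> by \<delta> and fixes the complement.\<close>
  define E where "E = mat 1 + (p - 1) *\<^sub>R outer_product h h"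
  define V where "V = U ** E + q *\<^sub>R outer_product z h"
  define M where "M = mat 1 + (\<delta> - 1) *\<^sub>R outer_product h h"
  have tE: "transpose E = E" by (simp add: E_def transpose_add transpose_scalar transpose_outer_product)
  have tM: "transpose M = M" by (simp add: M_def transpose_add transpose_scalar transpose_outer_product)
  have oo: "outer_product h h ** outer_product h h = outer_product h h"
    by (simp add: matrix_mult_outer_product outer_product_vector_mult hh)
  have tV: "transpose V = E ** transpose U + q *\<^sub>R outer_product h z"
    by (simp add: V_def transpose_add transpose_scalar transpose_outer_product matrix_transpose_mul tE)
  have "transpose U ** V = E"
    using U by (simp add: V_def matrix_algebra matrix_mul_assoc Stiefel_def matrix_mult_outer_product Uz outer_product_zero)
  moreover have "outer_product h z ** V = q *\<^sub>R outer_product h h"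
    by (simp add: V_def matrix_algebra outer_product_matrix_mult matrix_transpose_mul matrix_vector_mul_assoc[symmetric] Uz
        transpose_outer_product outer_product_vector_mult zz outer_product_zero)
  ultimately have "transpose V ** V = E ** E + q\<^sup>2 *\<^sub>R outer_product h h"
    by (simp add: tV matrix_algebra matrix_mul_assoc[symmetric] power2_eq_square)
  also have "E ** E = mat 1 + (p\<^sup>2 - 1) *\<^sub>R outer_product h h"
    by (simp add: E_def matrix_algebra oo) (simp add: power2_eq_square algebra_simps flip: scaleR_add_left scaleR_2)
  also have "\<dots> + q\<^sup>2 *\<^sub>R outer_product h h = mat 1 + (p\<^sup>2 + q\<^sup>2 - 1) *\<^sub>R outer_product h h"
    by (simp add: algebra_simps)
  finally have V: "V \<in> Stiefel" by (simp add: Stiefel_def pq)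
  have "S ** V = S ** U ** E - (q * (s / \<rho>)) *\<^sub>R outer_product (S *v (U *v h)) h"
    by (simp add: V_def matrix_algebra matrix_mul_assoc matrix_mult_outer_product Sz outer_product_scaleR_left
        outer_product_minus_left)
  also have "outer_product (S *v (U *v h)) h = S ** U ** outer_product h h"
    by (simp add: matrix_mult_outer_product matrix_vector_mul_assoc)
  also have "S ** U ** E - (q * (s / \<rho>)) *\<^sub>R (S ** U ** outer_product h h)
      = S ** U ** (mat 1 + (p - q * (s / \<rho>) - 1) *\<^sub>R outer_product h h)"
    by (simp add: E_def matrix_algebra algebra_simps)
  finally have SV: "S ** V = S ** U ** M" by (simp only: pqs M_def)
  have VS: "transpose V ** S = M ** transpose U ** S"
    using arg_cong[OF SV, of transpose] by (simp add: matrix_transpose_mul sym tM matrix_mul_assoc)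
  have VSV: "transpose V ** S ** V = M ** ?B ** M"
  proof -
    have "transpose V ** S ** V = M ** transpose U ** (S ** V)" by (simp add: VS matrix_mul_assoc)
    then show ?thesis by (simp add: SV matrix_mul_assoc)
  qed
  have "det M = \<delta>" by (simp add: M_def det_rank_one_update[OF h(1)])
  then have "det (transpose V ** S ** V) = \<delta>\<^sup>2 * det ?B"
    by (simp add: VSV det_mul power2_eq_square)
  moreover have "trace (transpose V ** S ** V) \<le> trace ?B"
  proof -
    have "M ** M = mat 1 + (\<delta>\<^sup>2 - 1) *\<^sub>R outer_product h h"
      by (simp add: M_def matrix_algebra oo) (simp add: power2_eq_square algebra_simps flip: scaleR_add_left scaleR_2)
    moreover have "trace (M ** ?B ** M) = trace (?B ** (M ** M))"
      using trace_mul_sym[of M "?B ** M"] by (simp add: matrix_mul_assoc)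
    ultimately have "trace (transpose V ** S ** V) = trace ?B + (\<delta>\<^sup>2 - 1) * (h \<bullet> (?B *v h))"
      by (simp add: VSV matrix_algebra trace_add trace_scaleR matrix_mult_outer_product trace_outer_product inner_commute)
    moreover have "0 \<le> h \<bullet> (?B *v h)" by (simp add: sandwich_inner psd)
    moreover have "\<delta>\<^sup>2 - 1 \<le> 0" using \<delta> by (simp add: power_le_one)
    ultimately show ?thesis by (simp add: mult_nonpos_nonneg)
  qed
  ultimately show ?thesis using that V by blast
qed

lemma not_SPD_kernel:
  assumes "transpose S = S" "\<And>v. 0 \<le> v \<bullet> (S *v v)" "S \<notin> SPD"
  obtains w where "w \<noteq> 0" "S *v w = 0"
proof -
  obtain w where w: "w \<noteq> 0" "\<not> 0 < w \<bullet> (S *v w)" using assms(1,3) by (auto simp: SPD_def)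
  then have "w \<bullet> (S *v w) = 0" using assms(2)[of w] by simp
  then show ?thesis using that w(1) nonneg_form_kernel[OF assms(1,2)] by blast
qed

lemma arg_min_G_fixed_imp_SPD:
  fixes U :: "real^'d^'n"
  assumes sym: "transpose S = S" and psd: "\<And>v. 0 \<le> v \<bullet> (S *v v)" and \<alpha>: "0 < \<alpha>" and \<sigma>: "0 < \<sigma>"
    and U: "is_arg_min (G_fixed S \<alpha> \<sigma>) (\<lambda>V. V \<in> G_fixed_dom S) U"
  shows "S \<in> SPD"
proof (rule ccontr)
  assume "S \<notin> SPD"
  then obtain w where w: "w \<noteq> 0" "S *v w = 0" using not_SPD_kernel[OF sym psd] by blast
  let ?B = "transpose U ** S ** U"
  have dU: "U \<in> Stiefel" "0 < det ?B" using U by (auto simp: is_arg_min_def G_fixed_dom_def)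
  \<comment> \<open>The trace term of G is nonpositive at \<open>V\<close>, so it rises by at most
    tr B / sigma^2 = 2 alpha t. The factor exp (- t - 1) lowers the logarithmic term by 2 alpha (t +
    1), a net decrease of at least 2 alpha.\<close>
  define t where "t = trace ?B / (2 * \<alpha> * \<sigma>\<^sup>2)"
  have t: "0 \<le> t" using trace_sandwich_nonneg[OF psd, of U] \<alpha> by (simp add: t_def)
  obtain V :: "real^'d^'n" where V: "V \<in> Stiefel"
    "det (transpose V ** S ** V) = (exp (- t - 1))\<^sup>2 * det ?B"
    using Stiefel_rotate_towards_kernel[OF dU(1) sym psd w, of "exp (- t - 1)"] dU(2) t by auto
  have "V \<in> G_fixed_dom S" using V dU(2) by (simp add: G_fixed_dom_def)
  then have "G_fixed S \<alpha> \<sigma> U \<le> G_fixed S \<alpha> \<sigma> V" using U by (auto simp: is_arg_min_linorder)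
  moreover have "ln (det (transpose V ** S ** V)) = 2 * (- t - 1) + ln (det ?B)"
    using dU(2) by (simp add: V(2) ln_mult_pos ln_realpow)
  moreover have "0 \<le> (1 / \<sigma>\<^sup>2) * trace (transpose V ** S ** V)"
    using trace_sandwich_nonneg[OF psd, of V] by simp
  ultimately have "- (1 / \<sigma>\<^sup>2) * trace ?B \<le> \<alpha> * (2 * (- t - 1))"
    by (simp add: G_fixed_def distrib_left)
  also have "\<dots> = - (1 / \<sigma>\<^sup>2) * trace ?B - 2 * \<alpha>"
    using \<alpha> \<sigma> by (simp add: t_def field_simps)
  finally show False using \<alpha> by simp
qed

text \<open>The trace bound of the rotation matters twice: it keeps tr S - tr (V^T S V) positive, so
  that \<open>V\<close> stays in the domain, and nonnegativity of tr (V^T S V) bounds the first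
  logarithm by ln (tr S).\<close>

lemma arg_min_G_learned_imp_SPD:
  fixes U :: "real^'d^'n"
  assumes dim: "CARD('d) < CARD('n)"
    and sym: "transpose S = S" and psd: "\<And>v. 0 \<le> v \<bullet> (S *v v)"
    and U: "is_arg_min (G_learned S) (\<lambda>V. V \<in> G_learned_dom S) U"
  shows "S \<in> SPD"
proof (rule ccontr)
  assume "S \<notin> SPD"
  then obtain w where w: "w \<noteq> 0" "S *v w = 0" using not_SPD_kernel[OF sym psd] by blast
  let ?B = "transpose U ** S ** U"
  define k where "k = real CARD('n) - real CARD('d)"
  have dU: "U \<in> Stiefel" "0 < trace S - trace ?B" "0 < det ?B"
    using U by (auto simp: is_arg_min_def G_learned_dom_def)
  \<comment> \<open>2 t is the most that the first term of G can rise; the logarithm of the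
    determinant falls by 2 t + 2.\<close>
  define t where "t = k * (ln (trace S) - ln (trace S - trace ?B)) / 2"
  have k: "0 < k" using dim by (simp add: k_def)
  have trB: "0 \<le> trace ?B" by (rule trace_sandwich_nonneg[OF psd])
  have t: "0 \<le> t" using k dU(2) trB by (simp add: t_def)
  obtain V :: "real^'d^'n" where V: "V \<in> Stiefel"
    "det (transpose V ** S ** V) = (exp (- t - 1))\<^sup>2 * det ?B"
    "trace (transpose V ** S ** V) \<le> trace ?B"
    using Stiefel_rotate_towards_kernel[OF dU(1) sym psd w, of "exp (- t - 1)"] dU(3) t by auto
  have "V \<in> G_learned_dom S" using V dU by (simp add: G_learned_dom_def)
  then have "G_learned S U \<le> G_learned S V" using U by (auto simp: is_arg_min_linorder)
  moreover have "ln (det (transpose V ** S ** V)) = 2 * (- t - 1) + ln (det ?B)"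
    using dU(3) by (simp add: V(2) ln_mult_pos ln_realpow)
  moreover have "0 \<le> trace (transpose V ** S ** V)" by (rule trace_sandwich_nonneg[OF psd])
  then have "k * ln (trace S - trace (transpose V ** S ** V)) \<le> k * ln (trace S)"
    using V(3) dU(2) k by (intro mult_left_mono) auto
  ultimately have "k * ln (trace S - trace ?B) \<le> k * ln (trace S) + 2 * (- t - 1)"
    by (simp add: G_learned_def flip: k_def)
  moreover have "2 * t = k * ln (trace S) - k * ln (trace S - trace ?B)"
    by (simp add: t_def right_diff_distrib)
  ultimately show False by (simp add: algebra_simps)
qed

subsection \<open>Existence of minimizers\<close>

lemma G_fixed_dom_SPD:
  fixes S :: "real^'n^'n"
  assumes "S \<in> SPD"
  shows "(G_fixed_dom S :: (real^'d^'n) set) = Stiefel"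
proof -
  have "0 < det (transpose V ** S ** V)" if "V \<in> Stiefel" for V :: "real^'d^'n"
    by (intro SPD_det_pos SPD_sandwich assms Stiefel_injective[OF that])
  then show ?thesis by (auto simp: G_fixed_dom_def)
qed

lemma G_learned_dom_SPD:
  fixes S :: "real^'n^'n"
  assumes "S \<in> SPD" "CARD('d::finite) < CARD('n)"
  shows "(G_learned_dom S :: (real^'d^'n) set) = Stiefel"
  using G_fixed_dom_SPD[OF assms(1), where 'd = 'd] trace_compression_less[OF assms(2) _ assms(1)]
  by (auto simp: G_learned_dom_def G_fixed_dom_def)

lemma Stiefel_nonempty:
  assumes "CARD('d::finite) \<le> CARD('n::finite)"
  shows "(Stiefel :: (real^'d^'n) set) \<noteq> {}"
proof -
  obtain e :: "'d \<Rightarrow> 'n" where e: "inj e" using assms obtain_inj by blast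
  have "column j ((\<chi> i j. if i = e j then 1 else 0) :: real^'d^'n) = axis (e j) 1" for j
    by (simp add: column_def axis_def vec_eq_iff)
  then have "((\<chi> i j. if i = e j then 1 else 0) :: real^'d^'n) \<in> Stiefel"
    using e by (simp add: Stiefel_columns inner_axis_axis inj_eq)
  then show ?thesis by auto
qed

lemma continuous_on_sandwich:
  fixes S :: "real^'n^'n"
  shows "continuous_on A (\<lambda>V :: real^'d^'n. transpose V ** S ** V)"
  unfolding matrix_matrix_mult_def transpose_def
  by (intro continuous_on_vec_lambda continuous_on_sum continuous_on_mult continuous_intros)

lemma compact_Stiefel: "compact (Stiefel :: (real^'d^'n) set)"
proof -
  have "continuous_on UNIV (\<lambda>V :: real^'d^'n. transpose V ** V)"
    using continuous_on_sandwich[where S = "mat 1"] by simp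
  then have "closed (Stiefel :: (real^'d^'n) set)"
    unfolding Stiefel_def by (intro closed_Collect_eq) auto
  moreover have "bounded (Stiefel :: (real^'d^'n) set)"
    unfolding bounded_iff
  proof (intro exI ballI)
    fix V :: "real^'d^'n" assume V: "V \<in> Stiefel"
    have "\<bar>V $ i $ j\<bar> \<le> 1" for i j
      using component_le_norm_cart[of "column j V" i] V by (simp add: Stiefel_columns norm_eq_sqrt_inner column_def)
    then have "norm (V $ i) \<le> CARD('d)" for i
      using norm_le_l1_cart[of "V $ i"] sum_bounded_above[of UNIV "\<lambda>j. \<bar>V $ i $ j\<bar>" 1] by force
    then have "(\<Sum>i\<in>UNIV. norm (V $ i)) \<le> CARD('n) * CARD('d)"
      using sum_bounded_above[of UNIV "\<lambda>i. norm (V $ i)" "real CARD('d)"] by simp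
    moreover have "norm V \<le> (\<Sum>i\<in>UNIV. norm (V $ i))"
      unfolding norm_vec_def[of V] by (intro L2_set_le_sum) auto
    ultimately show "norm V \<le> CARD('n) * CARD('d)" by linarith
  qed
  ultimately show ?thesis by (simp add: compact_eq_bounded_closed)
qed

lemma continuous_on_det [continuous_intros]:
  fixes f :: "'a::topological_space \<Rightarrow> real^'n^'n"
  assumes "continuous_on A f"
  shows "continuous_on A (\<lambda>x. det (f x))"
  unfolding det_def by (intro continuous_intros assms)

lemma continuous_on_trace [continuous_intros]:
  fixes f :: "'a::topological_space \<Rightarrow> real^'n^'n"
  assumes "continuous_on A f"
  shows "continuous_on A (\<lambda>x. trace (f x))"
  unfolding trace_def by (intro continuous_intros assms)

lemma is_arg_min_on_compact:
  fixes f :: "'a::topological_space \<Rightarrow> real"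
  assumes "compact A" "A \<noteq> {}" "continuous_on A f"
  shows "\<exists>x. is_arg_min f (\<lambda>y. y \<in> A) x"
  using continuous_attains_inf[OF assms] by (auto simp: is_arg_min_linorder)

text \<open>Positive definiteness keeps the determinant nonzero on the whole Stiefel manifold, so G
  is continuous on a nonempty compact set.\<close>

lemma is_arg_min_G_fixed_exists:
  fixes S :: "real^'n^'n"
  assumes S: "S \<in> SPD" and dim: "CARD('d::finite) < CARD('n)"
  shows "\<exists>U :: real^'d^'n. is_arg_min (G_fixed S \<alpha> \<sigma>) (\<lambda>V. V \<in> Stiefel) U"
proof (rule is_arg_min_on_compact[OF compact_Stiefel Stiefel_nonempty])
  have "det (transpose V ** S ** V) \<noteq> 0" if "V \<in> Stiefel" for V :: "real^'d^'n"
  proof -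
    have "V \<in> G_fixed_dom S" using that G_fixed_dom_SPD[OF S] by blast
    then show ?thesis by (simp add: G_fixed_dom_def)
  qed
  then show "continuous_on Stiefel (G_fixed S \<alpha> \<sigma> :: real^'d^'n \<Rightarrow> real)"
    unfolding G_fixed_def[abs_def] by (intro continuous_intros continuous_on_sandwich) auto
qed (use dim in simp)

lemma is_arg_min_G_learned_exists:
  fixes S :: "real^'n^'n"
  assumes S: "S \<in> SPD" and dim: "CARD('d::finite) < CARD('n)"
  shows "\<exists>U :: real^'d^'n. is_arg_min (G_learned S) (\<lambda>V. V \<in> Stiefel) U"
proof (rule is_arg_min_on_compact[OF compact_Stiefel Stiefel_nonempty])
  have "det (transpose V ** S ** V) \<noteq> 0 \<and> trace S - trace (transpose V ** S ** V) \<noteq> 0"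
    if "V \<in> Stiefel" for V :: "real^'d^'n"
  proof -
    have "V \<in> G_learned_dom S" using that G_learned_dom_SPD[OF S dim] by blast
    then show ?thesis by (simp add: G_learned_dom_def)
  qed
  then show "continuous_on Stiefel (G_learned S :: real^'d^'n \<Rightarrow> real)"
    unfolding G_learned_def[abs_def] by (intro continuous_intros continuous_on_sandwich) auto
qed (use dim in simp)

subsection \<open>Maximizers of the objective function\<close>

lemma is_arg_max_J_fixed:
  fixes x :: "nat \<Rightarrow> real^'n" and U :: "real^'d^'n"
  assumes dim: "CARD('d) < CARD('n)"
    and \<alpha>: "\<alpha> = weight_total \<beta> N" "0 < \<alpha>" and m: "m = first_moment x \<beta> N"
    and S: "S = scatter x \<beta> N" "S \<in> SPD" and \<sigma>: "0 < \<sigma>"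
    and U: "is_arg_min (G_fixed S \<alpha> \<sigma>) (\<lambda>V. V \<in> G_fixed_dom S) U"
  shows "is_arg_max (\<lambda>(V, b, \<mu>, \<Sigma>). J x \<beta> N V b \<mu> \<Sigma> \<sigma>)
     (\<lambda>p. p \<in> Stiefel \<times> UNIV \<times> UNIV \<times> SPD)
     (U, (1 / \<alpha>) *\<^sub>R m, 0 :: real^'d, (1 / \<alpha>) *\<^sub>R (transpose U ** S ** U))"
proof -
  have W: "transpose V ** S ** V \<in> SPD" if "V \<in> Stiefel" for V :: "real^'d^'n"
    by (intro SPD_sandwich S Stiefel_injective[OF that])
  have U': "U \<in> Stiefel" "\<And>V :: real^'d^'n. V \<in> Stiefel \<Longrightarrow> G_fixed S \<alpha> \<sigma> U \<le> G_fixed S \<alpha> \<sigma> V"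
    using U G_fixed_dom_SPD[OF S(2), where 'd = 'd] by (auto simp: is_arg_min_linorder)
  have "J x \<beta> N V b \<mu> \<Sigma> \<sigma>
      \<le> J x \<beta> N U ((1 / \<alpha>) *\<^sub>R m) 0 ((1 / \<alpha>) *\<^sub>R (transpose U ** S ** U)) \<sigma>"
    if "V \<in> Stiefel" "\<Sigma> \<in> SPD" for V :: "real^'d^'n" and b \<mu> \<Sigma>
    using J_le_G_fixed[OF dim \<alpha> m S(1) that(1) W[OF that(1)] \<sigma> that(2), of b \<mu>] U'(2)[OF that(1)]
    unfolding J_eq_G_fixed[OF dim \<alpha> m S(1) U'(1) W[OF U'(1)] \<sigma>] by argo
  then show ?thesis
    using U'(1) SPD_scaleR[OF W[OF U'(1)], of "1 / \<alpha>"] \<alpha>(2) by (auto simp: is_arg_max_linorder)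
qed

text \<open>The minimum over \<open>s = \<sigma>\<^sup>2\<close> is attained at \<open>s = T / k\<close>.\<close>

lemma variance_profile:
  fixes k s T :: real
  assumes "0 < k" "0 < s" "0 < T"
  shows "k * ln T - k * ln k + k \<le> k * ln s + T / s"
proof -
  \<comment> \<open>The tangent bound for ln is used at T / (k s), which equals 1 exactly at the
    minimizer s = T / k.\<close>
  have "ln (T / (k * s)) \<le> T / (k * s) - 1" using assms by (intro ln_le_minus_one) simp
  then have "k * (ln T - ln k - ln s) \<le> k * (T / (k * s) - 1)"
    using assms by (intro mult_left_mono) (simp_all add: ln_div ln_mult_pos)
  then show ?thesis using assms by (simp add: right_diff_distrib)
qed

text \<open>With s = sigma^2 the value left after optimizing \<open>b\<close>, \<open>\<mu>\<close>
  and \<open>\<Sigma>\<close> is K - (k ln s + T V / s + alpha D V) / 2. Eliminating s turns k ln s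
  + T V / s into k ln (T V) plus a constant, and k = alpha (n - d) makes k ln (T V) + alpha D V
  equal to alpha times \<open>G_learned\<close>.\<close>

lemma is_arg_max_J_learned:
  fixes x :: "nat \<Rightarrow> real^'n" and U :: "real^'d^'n"
  assumes dim: "CARD('d) < CARD('n)"
    and \<alpha>: "\<alpha> = weight_total \<beta> N" "0 < \<alpha>" and m: "m = first_moment x \<beta> N"
    and S: "S = scatter x \<beta> N" "S \<in> SPD"
    and U: "is_arg_min (G_learned S) (\<lambda>V. V \<in> G_learned_dom S) U"
  shows "is_arg_max (\<lambda>(V, b, \<mu>, \<Sigma>, \<sigma>). J x \<beta> N V b \<mu> \<Sigma> \<sigma>)
     (\<lambda>p. p \<in> Stiefel \<times> UNIV \<times> UNIV \<times> SPD \<times> {0<..})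
     (U, (1 / \<alpha>) *\<^sub>R m, 0 :: real^'d, (1 / \<alpha>) *\<^sub>R (transpose U ** S ** U),
      sqrt (1 / (\<alpha> * (real CARD('n) - real CARD('d))) * (trace S - trace (transpose U ** S ** U))))"
proof -
  define k where "k = \<alpha> * (real CARD('n) - real CARD('d))"
  define T where "T V = trace S - trace (transpose V ** S ** V)" for V :: "real^'d^'n"
  define D where "D V = ln (det (transpose V ** S ** V))" for V :: "real^'d^'n"
  define K where "K = - (\<alpha> * real CARD('n) / 2) * ln (2 * pi) - (\<alpha> * CARD('d) - \<alpha> * CARD('d) * ln \<alpha>) / 2"
  have k: "0 < k" using \<alpha>(2) dim by (simp add: k_def)
  have W: "transpose V ** S ** V \<in> SPD" if "V \<in> Stiefel" for V :: "real^'d^'n"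
    by (intro SPD_sandwich S Stiefel_injective[OF that])
  have T: "0 < T V" if "V \<in> Stiefel" for V
    using trace_compression_less[OF dim that S(2)] by (simp add: T_def)
  have U': "U \<in> Stiefel" "\<And>V :: real^'d^'n. V \<in> Stiefel \<Longrightarrow> G_learned S U \<le> G_learned S V"
    using U G_learned_dom_SPD[OF S(2) dim] by (auto simp: is_arg_min_linorder)
  have G: "\<alpha> * G_learned S V = k * ln (T V) + \<alpha> * D V" for V :: "real^'d^'n"
    by (simp add: G_learned_def k_def T_def D_def distrib_left)
  have M: "- (\<alpha> * real CARD('n) / 2) * ln (2 * pi)
     - (\<alpha> * ((real CARD('n) - real CARD('d)) * ln (\<sigma>\<^sup>2) + CARD('d) - CARD('d) * ln \<alpha>)
        + trace S / \<sigma>\<^sup>2 + G_fixed S \<alpha> \<sigma> V) / 2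
     = K - (k * ln (\<sigma>\<^sup>2) + T V / \<sigma>\<^sup>2 + \<alpha> * D V) / 2" for V :: "real^'d^'n" and \<sigma>
    by (simp add: G_fixed_def K_def k_def T_def D_def diff_divide_distrib add_divide_distrib
        distrib_left right_diff_distrib left_diff_distrib del: ln_realpow)
  define s where "s = sqrt (1 / k * T U)"
  have s: "0 < s" "s\<^sup>2 = T U / k" using T[OF U'(1)] k by (simp_all add: s_def)
  have "J x \<beta> N V b \<mu> \<Sigma> \<sigma>
      \<le> J x \<beta> N U ((1 / \<alpha>) *\<^sub>R m) 0 ((1 / \<alpha>) *\<^sub>R (transpose U ** S ** U)) s"
    if "V \<in> Stiefel" "\<Sigma> \<in> SPD" "0 < \<sigma>" for V :: "real^'d^'n" and b \<mu> \<Sigma> \<sigma>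
  proof -
    have "J x \<beta> N V b \<mu> \<Sigma> \<sigma> \<le> K - (k * ln (\<sigma>\<^sup>2) + T V / \<sigma>\<^sup>2 + \<alpha> * D V) / 2"
      using J_le_G_fixed[OF dim \<alpha> m S(1) that(1) W[OF that(1)] that(3,2), of b \<mu>] unfolding M .
    moreover have "k * ln (T V) - k * ln k + k \<le> k * ln (\<sigma>\<^sup>2) + T V / \<sigma>\<^sup>2"
      using variance_profile[OF k _ T[OF that(1)], of "\<sigma>\<^sup>2"] that(3) by simp
    moreover have "\<alpha> * G_learned S U \<le> \<alpha> * G_learned S V"
      using U'(2)[OF that(1)] \<alpha>(2) by (intro mult_left_mono) auto
    moreover have "J x \<beta> N U ((1 / \<alpha>) *\<^sub>R m) 0 ((1 / \<alpha>) *\<^sub>R (transpose U ** S ** U)) s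
        = K - (k * ln (T U) - k * ln k + k + \<alpha> * D U) / 2"
    proof -
      have "k * ln (s\<^sup>2) = k * ln (T U) - k * ln k" "T U / s\<^sup>2 = k"
        using k T[OF U'(1)] by (simp_all add: s(2) ln_div right_diff_distrib)
      then show ?thesis
        unfolding J_eq_G_fixed[OF dim \<alpha> m S(1) U'(1) W[OF U'(1)] s(1)] M by simp
    qed
    ultimately show ?thesis unfolding G by argo
  qed
  then show ?thesis
    using U'(1) s(1) SPD_scaleR[OF W[OF U'(1)], of "1 / \<alpha>"] \<alpha>(2)
    unfolding k_def[symmetric] T_def[symmetric] s_def[symmetric]
    by (auto simp: is_arg_max_linorder)
qed

section \<open>Vanishing weights and the final assembly\<close>

lemma weight_total_pos:
  assumes "\<forall>i\<in>{1..N}. 0 \<le> \<beta> i" "i \<in> {1..N}" "0 < \<beta> i"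
  shows "0 < weight_total \<beta> N"
  unfolding weight_total_def using assms by (intro sum_pos2[of _ i]) auto

lemma scatter_zero:
  assumes "\<And>i. i \<in> {1..N} \<Longrightarrow> \<beta> i = 0"
  shows "scatter x \<beta> N = 0"
proof -
  have "first_moment x \<beta> N = 0" "second_moment x \<beta> N = 0"
    unfolding first_moment_def second_moment_def using assms by (auto intro!: sum.neutral)
  then show ?thesis by (simp add: scatter_def outer_eq_outer_product outer_product_zero)
qed

text \<open>The first two conjuncts concern a given minimizer. The third guards against vacuity: it
  supplies minimizers over the full Stiefel manifold. The square root appears because the parameter
  is sigma, while the closed formula is for its square.\<close>

theorem proposition4p2:
  fixes x :: "nat \<Rightarrow> real^'n" and \<beta> :: "nat \<Rightarrow> real" and N :: nat
    and \<alpha> :: real and m :: "real^'n" and S :: "real^'n^'n"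
  assumes dim: "CARD('d::finite) < CARD('n)"
    and points: "affinely_independent_points x {1..N}"
    and weights: "\<forall>i\<in>{1..N}. 0 \<le> \<beta> i"
    and alpha_eq: "\<alpha> = weight_total \<beta> N"
    and m_eq: "m = first_moment x \<beta> N"
    and S_eq: "S = scatter x \<beta> N"
  shows
    "(\<forall>\<sigma>>0. \<forall>U :: real^'d^'n.
         is_arg_min (G_fixed S \<alpha> \<sigma>) (\<lambda>V. V \<in> G_fixed_dom S) U \<longrightarrow>
         is_arg_max (\<lambda>(V, b, \<mu>, \<Sigma>). J x \<beta> N V b \<mu> \<Sigma> \<sigma>)
           (\<lambda>p. p \<in> Stiefel \<times> UNIV \<times> UNIV \<times> SPD)
           (U, (1 / \<alpha>) *\<^sub>R m, 0 :: real^'d, (1 / \<alpha>) *\<^sub>R (transpose U ** S ** U)))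
     \<and>
     (\<forall>U :: real^'d^'n.
         is_arg_min (G_learned S) (\<lambda>V. V \<in> G_learned_dom S) U \<longrightarrow>
         is_arg_max (\<lambda>(V, b, \<mu>, \<Sigma>, \<sigma>). J x \<beta> N V b \<mu> \<Sigma> \<sigma>)
           (\<lambda>p. p \<in> Stiefel \<times> UNIV \<times> UNIV \<times> SPD \<times> {0<..})
           (U, (1 / \<alpha>) *\<^sub>R m, 0 :: real^'d, (1 / \<alpha>) *\<^sub>R (transpose U ** S ** U),
            sqrt (1 / (\<alpha> * (real CARD('n) - real CARD('d)))
                    * (trace S - trace (transpose U ** S ** U)))))
     \<and>
     (affinely_independent_points x {i\<in>{1..N}. 0 < \<beta> i} \<longrightarrow>
         (G_fixed_dom S :: (real^'d^'n) set) = Stiefel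
         \<and> (\<forall>\<sigma>>0. \<exists>U :: real^'d^'n. is_arg_min (G_fixed S \<alpha> \<sigma>) (\<lambda>V. V \<in> Stiefel) U)
         \<and> (G_learned_dom S :: (real^'d^'n) set) = Stiefel
         \<and> (\<exists>U :: real^'d^'n. is_arg_min (G_learned S) (\<lambda>V. V \<in> Stiefel) U))"
proof -
  \<comment> \<open>If alpha were not positive, all weights and hence S would vanish, and the d x d
    zero matrix has determinant 0 because d >= 1.\<close>
  have \<alpha>_pos: "0 < \<alpha>" if "0 < det (transpose U ** S ** U)" for U :: "real^'d^'n"
  proof (rule ccontr)
    assume "\<not> 0 < \<alpha>"
    then have "\<beta> i = 0" if "i \<in> {1..N}" for i
      using weight_total_pos[OF weights that] weights that alpha_eq by force
    then have "S = 0" unfolding S_eq by (rule scatter_zero)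
    then show False using that det_0[where 'n = 'd and 'a = real] by simp
  qed
  have sym: "transpose S = S" by (simp add: S_eq scatter_symmetric)
  have psd: "0 \<le> v \<bullet> (S *v v)" if "0 < \<alpha>" for v
    using scatter_nonneg[OF alpha_eq _ weights] that by (simp add: S_eq)
  have "is_arg_max (\<lambda>(V, b, \<mu>, \<Sigma>). J x \<beta> N V b \<mu> \<Sigma> \<sigma>)
           (\<lambda>p. p \<in> Stiefel \<times> UNIV \<times> UNIV \<times> SPD)
           (U, (1 / \<alpha>) *\<^sub>R m, 0 :: real^'d, (1 / \<alpha>) *\<^sub>R (transpose U ** S ** U))"
    if \<sigma>: "0 < \<sigma>" and U: "is_arg_min (G_fixed S \<alpha> \<sigma>) (\<lambda>V. V \<in> G_fixed_dom S) U"
    for \<sigma> and U :: "real^'d^'n"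
  proof -
    have \<alpha>: "0 < \<alpha>" using U by (intro \<alpha>_pos) (auto simp: is_arg_min_def G_fixed_dom_def)
    show ?thesis
      by (rule is_arg_max_J_fixed[OF dim alpha_eq \<alpha> m_eq S_eq _ \<sigma> U])
        (rule arg_min_G_fixed_imp_SPD[OF sym psd[OF \<alpha>] \<alpha> \<sigma> U])
  qed
  moreover have "is_arg_max (\<lambda>(V, b, \<mu>, \<Sigma>, \<sigma>). J x \<beta> N V b \<mu> \<Sigma> \<sigma>)
           (\<lambda>p. p \<in> Stiefel \<times> UNIV \<times> UNIV \<times> SPD \<times> {0<..})
           (U, (1 / \<alpha>) *\<^sub>R m, 0 :: real^'d, (1 / \<alpha>) *\<^sub>R (transpose U ** S ** U),
            sqrt (1 / (\<alpha> * (real CARD('n) - real CARD('d)))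
                    * (trace S - trace (transpose U ** S ** U))))"
    if U: "is_arg_min (G_learned S) (\<lambda>V. V \<in> G_learned_dom S) U" for U :: "real^'d^'n"
  proof -
    have \<alpha>: "0 < \<alpha>" using U by (intro \<alpha>_pos) (auto simp: is_arg_min_def G_learned_dom_def)
    show ?thesis
      by (rule is_arg_max_J_learned[OF dim alpha_eq \<alpha> m_eq S_eq _ U])
        (rule arg_min_G_learned_imp_SPD[OF dim sym psd[OF \<alpha>] U])
  qed
  moreover have "S \<in> SPD" if pos: "affinely_independent_points x {i\<in>{1..N}. 0 < \<beta> i}"
  proof -
    obtain K where K: "K \<subseteq> {i\<in>{1..N}. 0 < \<beta> i}" "card K = CARD('n) + 1"
      using pos by (auto simp: affinely_independent_points_def)
    then have "K \<noteq> {}" by auto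
    then obtain i where "i \<in> {1..N}" "0 < \<beta> i" using K(1) by auto
    then have "\<alpha> \<noteq> 0" using weight_total_pos[OF weights] alpha_eq by force
    then show ?thesis using scatter_SPD[OF alpha_eq _ weights pos] S_eq by simp
  qed
  ultimately show ?thesis
    using G_fixed_dom_SPD[where 'd = 'd] G_learned_dom_SPD[OF _ dim] is_arg_min_G_fixed_exists[OF _ dim]
      is_arg_min_G_learned_exists[OF _ dim] by blast
qed

end
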